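(* Let $G=N\rtimes H$, $M$, $\mathcal U$, $H^+$, $D$, $\alpha$, $A=D\rtimes_\alpha G$ and $p=\chi_M$ be as in the context, with $\mathcal U$ having finite quotients, and assume that $H$ is abelian and $N=\bigcup_{a\in H^+}a^{-1}Ma$. For $a\in H^+$ and $m\in M$ define elements of $pAp$ by $s_a=pap$ and $u(m)=pmp$. Then $\{s_a,u(m):a\in H^+,m\in M\}$ is an SU-family that generates $pAp$ as a $C^*$-algebra.
   Context: $G=N\rtimes H$ is a discrete group which is a semidirect product with normal subgroup $N$ and quotient group $H$ (regarded as a subgroup of $G$, acting on $N$ by conjugation), and $M\neq\{e\}$ is a normal subgroup of $N$. Put $\mathcal U=\{aMa^{-1}:a\in H\}$. Standing assumptions: (filter base) for all $U,V\in\mathcal U$ there is $W\in\mathcal U$ with $W\subseteq U\cap V$; (separating) $\bigcap_{U\in\mathcal U}U=\{e\}$; (finite quotients) $|U/V|<\infty$ whenever $V\subseteq U$ in $\mathcal U$. Put $H^+=\{a\in H:aMa^{-1}\subseteq M\}$. For $g=xa\in G$ with $x\in N$, $a\in H$, let $\beta_g(y)=xaya^{-1}$ for $y\in N$, and let $\alpha_g(f)=f\circ\beta_{g^{-1}}$ for $f\in\ell^\infty(N)$. $D$ is the $C^*$-subalgebra of $\ell^\infty(N)$ generated by the characteristic functions $\chi_{xU}$, $x\in N$, $U\in\mathcal U$; $\alpha$ restricts to an action of $G$ on $D$. $A=D\rtimes_\alpha G$ is the full crossed product; elements of $D$ and $G$ are identified with their images in the multiplier algebra of $A$. $p=\chi_M$,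 and $pAp$ is unital with unit $p$. An SU-family in a unital $C^*$-algebra $B$ consists of a set $\{S_a:a\in H^+\}$ of isometries ($S_a^*S_a=1$) in $B$ and a set $\{U(m):m\in M\}$ of unitaries in $B$ satisfying, for all $a,b\in H^+$ and $m,k\in M$: (1) $S_aS_b=S_{ab}$; (2) $S_aU(m)=U(ama^{-1})S_a$; (3) $\sum_{maMa^{-1}\in M/aMa^{-1}}U(m)S_aS_a^*U(m^{-1})=1$ (sum over the finitely many cosets, $m$ a representative of the coset); (4) $U(m)U(k)=U(mk)$. *)

theory Defs
  imports Complex_Main "HOL-Algebra.Module" "HOL-Algebra.Left_Coset"
begin

section \<open>C*-algebras\<close>

text \<open>
  A C*-algebra is a record extending the HOL-Algebra ring and module records (over the complex
  numbers). The field \<^term>\<open>one\<close> carries no meaning unless the algebra is declared to be unital.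
\<close>

record 'a cstar_alg = "(complex, 'a) module" +
  star :: "'a \<Rightarrow> 'a"
  cnorm :: "'a \<Rightarrow> real"

definition cconv :: "('a, 'm) cstar_alg_scheme \<Rightarrow> (nat \<Rightarrow> 'a) \<Rightarrow> 'a \<Rightarrow> bool" where
  "cconv A X x \<longleftrightarrow> (\<lambda>n. cnorm A (X n \<ominus>\<^bsub>A\<^esub> x)) \<longlonglongrightarrow> 0"

definition ccauchy :: "('a, 'm) cstar_alg_scheme \<Rightarrow> (nat \<Rightarrow> 'a) \<Rightarrow> bool" where
  "ccauchy A X \<longleftrightarrow> (\<forall>e>0. \<exists>k. \<forall>m\<ge>k. \<forall>n\<ge>k. cnorm A (X m \<ominus>\<^bsub>A\<^esub> X n) < e)"

locale cstar_algebra = abelian_group A for A (structure) +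
  assumes mult_closed: "\<lbrakk>x \<in> carrier A; y \<in> carrier A\<rbrakk> \<Longrightarrow> x \<otimes> y \<in> carrier A"
    and mult_assoc: "\<lbrakk>x \<in> carrier A; y \<in> carrier A; z \<in> carrier A\<rbrakk>
          \<Longrightarrow> (x \<otimes> y) \<otimes> z = x \<otimes> (y \<otimes> z)"
    and distrib_right: "\<lbrakk>x \<in> carrier A; y \<in> carrier A; z \<in> carrier A\<rbrakk>
          \<Longrightarrow> (x \<oplus> y) \<otimes> z = x \<otimes> z \<oplus> y \<otimes> z"
    and distrib_left: "\<lbrakk>x \<in> carrier A; y \<in> carrier A; z \<in> carrier A\<rbrakk>
          \<Longrightarrow> z \<otimes> (x \<oplus> y) = z \<otimes> x \<oplus> z \<otimes> y"
    and smult_closed: "x \<in> carrier A \<Longrightarrow> c \<odot> x \<in> carrier A"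
    and smult_add_right: "\<lbrakk>x \<in> carrier A; y \<in> carrier A\<rbrakk> \<Longrightarrow> c \<odot> (x \<oplus> y) = c \<odot> x \<oplus> c \<odot> y"
    and smult_add_left: "x \<in> carrier A \<Longrightarrow> (c + d) \<odot> x = c \<odot> x \<oplus> d \<odot> x"
    and smult_smult: "x \<in> carrier A \<Longrightarrow> (c * d) \<odot> x = c \<odot> (d \<odot> x)"
    and smult_one: "x \<in> carrier A \<Longrightarrow> 1 \<odot> x = x"
    and smult_mult_left: "\<lbrakk>x \<in> carrier A; y \<in> carrier A\<rbrakk> \<Longrightarrow> (c \<odot> x) \<otimes> y = c \<odot> (x \<otimes> y)"
    and smult_mult_right: "\<lbrakk>x \<in> carrier A; y \<in> carrier A\<rbrakk> \<Longrightarrow> x \<otimes> (c \<odot> y) = c \<odot> (x \<otimes> y)"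
    and star_closed: "x \<in> carrier A \<Longrightarrow> star A x \<in> carrier A"
    and star_star: "x \<in> carrier A \<Longrightarrow> star A (star A x) = x"
    and star_add: "\<lbrakk>x \<in> carrier A; y \<in> carrier A\<rbrakk> \<Longrightarrow> star A (x \<oplus> y) = star A x \<oplus> star A y"
    and star_smult: "x \<in> carrier A \<Longrightarrow> star A (c \<odot> x) = cnj c \<odot> star A x"
    and star_mult: "\<lbrakk>x \<in> carrier A; y \<in> carrier A\<rbrakk> \<Longrightarrow> star A (x \<otimes> y) = star A y \<otimes> star A x"
    and norm_nonneg: "x \<in> carrier A \<Longrightarrow> 0 \<le> cnorm A x"
    and norm_eq_0_iff: "x \<in> carrier A \<Longrightarrow> cnorm A x = 0 \<longleftrightarrow> x = \<zero>"
    and norm_triangle: "\<lbrakk>x \<in> carrier A; y \<in> carrier A\<rbrakk> \<Longrightarrow> cnorm A (x \<oplus> y) \<le> cnorm A x + cnorm A y"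
    and norm_smult: "x \<in> carrier A \<Longrightarrow> cnorm A (c \<odot> x) = cmod c * cnorm A x"
    and norm_mult: "\<lbrakk>x \<in> carrier A; y \<in> carrier A\<rbrakk> \<Longrightarrow> cnorm A (x \<otimes> y) \<le> cnorm A x * cnorm A y"
    and cstar_identity: "x \<in> carrier A \<Longrightarrow> cnorm A (star A x \<otimes> x) = (cnorm A x)\<^sup>2"
    and complete: "\<lbrakk>\<And>n. X n \<in> carrier A; ccauchy A X\<rbrakk> \<Longrightarrow> \<exists>x\<in>carrier A. cconv A X x"

locale unital_cstar_algebra = cstar_algebra +
  assumes one_closed: "\<one> \<in> carrier A"
    and one_mult: "x \<in> carrier A \<Longrightarrow> \<one> \<otimes> x = x"
    and mult_one: "x \<in> carrier A \<Longrightarrow> x \<otimes> \<one> = x"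

definition cisometry :: "('a, 'm) cstar_alg_scheme \<Rightarrow> 'a \<Rightarrow> bool" where
  "cisometry A v \<longleftrightarrow> v \<in> carrier A \<and> star A v \<otimes>\<^bsub>A\<^esub> v = \<one>\<^bsub>A\<^esub>"

definition cunitary :: "('a, 'm) cstar_alg_scheme \<Rightarrow> 'a \<Rightarrow> bool" where
  "cunitary A u \<longleftrightarrow>
     u \<in> carrier A \<and> star A u \<otimes>\<^bsub>A\<^esub> u = \<one>\<^bsub>A\<^esub> \<and> u \<otimes>\<^bsub>A\<^esub> star A u = \<one>\<^bsub>A\<^esub>"

definition closed_subspace :: "('a, 'm) cstar_alg_scheme \<Rightarrow> 'a set \<Rightarrow> bool" where
  "closed_subspace A C \<longleftrightarrow>
     C \<subseteq> carrier A \<and> \<zero>\<^bsub>A\<^esub> \<in> C \<and>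
     (\<forall>x\<in>C. \<forall>y\<in>C. x \<oplus>\<^bsub>A\<^esub> y \<in> C) \<and>
     (\<forall>c. \<forall>x\<in>C. c \<odot>\<^bsub>A\<^esub> x \<in> C) \<and>
     (\<forall>X x. (\<forall>n. X n \<in> C) \<and> x \<in> carrier A \<and> cconv A X x \<longrightarrow> x \<in> C)"

definition closed_span :: "('a, 'm) cstar_alg_scheme \<Rightarrow> 'a set \<Rightarrow> 'a set" where
  "closed_span A S = \<Inter>{C. closed_subspace A C \<and> S \<subseteq> C}"

definition cstar_subalgebra :: "('a, 'm) cstar_alg_scheme \<Rightarrow> 'a set \<Rightarrow> bool" where
  "cstar_subalgebra A C \<longleftrightarrow>
     closed_subspace A C \<and> (\<forall>x\<in>C. \<forall>y\<in>C. x \<otimes>\<^bsub>A\<^esub> y \<in> C) \<and> (\<forall>x\<in>C. star A x \<in> C)"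

definition cstar_generated :: "('a, 'm) cstar_alg_scheme \<Rightarrow> 'a set \<Rightarrow> 'a set" where
  "cstar_generated A S = \<Inter>{C. cstar_subalgebra A C \<and> S \<subseteq> C}"

definition cstar_hom :: "('a, 'm) cstar_alg_scheme \<Rightarrow> ('b, 'n) cstar_alg_scheme \<Rightarrow> ('a \<Rightarrow> 'b) set" where
  "cstar_hom A B = {\<phi> \<in> carrier A \<rightarrow> carrier B.
     (\<forall>x\<in>carrier A. \<forall>y\<in>carrier A. \<phi> (x \<oplus>\<^bsub>A\<^esub> y) = \<phi> x \<oplus>\<^bsub>B\<^esub> \<phi> y) \<and>
     (\<forall>c. \<forall>x\<in>carrier A. \<phi> (c \<odot>\<^bsub>A\<^esub> x) = c \<odot>\<^bsub>B\<^esub> \<phi> x) \<and>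
     (\<forall>x\<in>carrier A. \<forall>y\<in>carrier A. \<phi> (x \<otimes>\<^bsub>A\<^esub> y) = \<phi> x \<otimes>\<^bsub>B\<^esub> \<phi> y) \<and>
     (\<forall>x\<in>carrier A. \<phi> (star A x) = star B (\<phi> x))}"


section \<open>Multiplier algebras\<close>

text \<open>
  The multiplier algebra is realised as the algebra of double centralisers \<open>(L, R)\<close>; a multiplier
  \<open>T\<close> corresponds to \<open>L a = T a\<close> and \<open>R a = a T\<close>. The maps are taken extensional so that equality
  of double centralisers is equality on the algebra.
\<close>

type_synonym 'a dcent = "('a \<Rightarrow> 'a) \<times> ('a \<Rightarrow> 'a)"

definition bounded_lin_map :: "('a, 'm) cstar_alg_scheme \<Rightarrow> ('a \<Rightarrow> 'a) \<Rightarrow> bool" where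
  "bounded_lin_map A L \<longleftrightarrow>
     L \<in> carrier A \<rightarrow>\<^sub>E carrier A \<and>
     (\<forall>x\<in>carrier A. \<forall>y\<in>carrier A. L (x \<oplus>\<^bsub>A\<^esub> y) = L x \<oplus>\<^bsub>A\<^esub> L y) \<and>
     (\<forall>c. \<forall>x\<in>carrier A. L (c \<odot>\<^bsub>A\<^esub> x) = c \<odot>\<^bsub>A\<^esub> L x) \<and>
     (\<exists>K. \<forall>x\<in>carrier A. cnorm A (L x) \<le> K * cnorm A x)"

definition double_centralisers :: "('a, 'm) cstar_alg_scheme \<Rightarrow> 'a dcent set" where
  "double_centralisers A = {(L, R). bounded_lin_map A L \<and> bounded_lin_map A R \<and>
     (\<forall>x\<in>carrier A. \<forall>y\<in>carrier A.
        L (x \<otimes>\<^bsub>A\<^esub> y) = L x \<otimes>\<^bsub>A\<^esub> y \<and>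
        R (x \<otimes>\<^bsub>A\<^esub> y) = x \<otimes>\<^bsub>A\<^esub> R y \<and>
        R x \<otimes>\<^bsub>A\<^esub> y = x \<otimes>\<^bsub>A\<^esub> L y)}"

definition multiplier :: "('a, 'm) cstar_alg_scheme \<Rightarrow> 'a dcent cstar_alg" where
  "multiplier A =
     \<lparr>carrier = double_centralisers A,
      mult = (\<lambda>(L1, R1) (L2, R2).
        (\<lambda>a\<in>carrier A. L1 (L2 a), \<lambda>a\<in>carrier A. R2 (R1 a))),
      one = (\<lambda>a\<in>carrier A. a, \<lambda>a\<in>carrier A. a),
      zero = (\<lambda>a\<in>carrier A. \<zero>\<^bsub>A\<^esub>, \<lambda>a\<in>carrier A. \<zero>\<^bsub>A\<^esub>),
      add = (\<lambda>(L1, R1) (L2, R2).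
        (\<lambda>a\<in>carrier A. L1 a \<oplus>\<^bsub>A\<^esub> L2 a, \<lambda>a\<in>carrier A. R1 a \<oplus>\<^bsub>A\<^esub> R2 a)),
      smult = (\<lambda>c (L, R). (\<lambda>a\<in>carrier A. c \<odot>\<^bsub>A\<^esub> L a, \<lambda>a\<in>carrier A. c \<odot>\<^bsub>A\<^esub> R a)),
      star = (\<lambda>(L, R).
        (\<lambda>a\<in>carrier A. star A (R (star A a)), \<lambda>a\<in>carrier A. star A (L (star A a)))),
      cnorm = (\<lambda>(L, R). SUP a\<in>{a \<in> carrier A. cnorm A a \<le> 1}. cnorm A (L a))\<rparr>"

definition mult_embed :: "('a, 'm) cstar_alg_scheme \<Rightarrow> 'a \<Rightarrow> 'a dcent" where
  "mult_embed A x = (\<lambda>a\<in>carrier A. x \<otimes>\<^bsub>A\<^esub> a, \<lambda>a\<in>carrier A. a \<otimes>\<^bsub>A\<^esub> x)"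

text \<open>The corner \<open>p A p\<close>, for \<open>p\<close> a projection in the multiplier algebra, with unit \<open>p\<close>.\<close>

definition corner :: "('a, 'm) cstar_alg_scheme \<Rightarrow> 'a dcent \<Rightarrow> 'a dcent cstar_alg" where
  "corner A p = (multiplier A)
     \<lparr>carrier := (\<lambda>x. p \<otimes>\<^bsub>multiplier A\<^esub> mult_embed A x \<otimes>\<^bsub>multiplier A\<^esub> p) ` carrier A,
      one := p\<rparr>"

definition nondegenerate ::
    "('d, 'm) cstar_alg_scheme \<Rightarrow> ('b, 'n) cstar_alg_scheme \<Rightarrow> ('d \<Rightarrow> 'b dcent) \<Rightarrow> bool" where
  "nondegenerate D B \<pi> \<longleftrightarrow>
     closed_span B {fst (\<pi> d) b | d b. d \<in> carrier D \<and> b \<in> carrier B} = carrier B"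


section \<open>Full crossed products by discrete groups\<close>

definition covariant_hom ::
    "('d, 'm) cstar_alg_scheme \<Rightarrow> ('g, 'k) monoid_scheme \<Rightarrow> ('g \<Rightarrow> 'd \<Rightarrow> 'd) \<Rightarrow>
     ('b, 'n) cstar_alg_scheme \<Rightarrow> ('d \<Rightarrow> 'b dcent) \<Rightarrow> ('g \<Rightarrow> 'b dcent) \<Rightarrow> bool" where
  "covariant_hom D G \<alpha> B \<pi> u \<longleftrightarrow>
     \<pi> \<in> cstar_hom D (multiplier B) \<and> nondegenerate D B \<pi> \<and>
     (\<forall>g\<in>carrier G. cunitary (multiplier B) (u g)) \<and>
     (\<forall>g\<in>carrier G. \<forall>h\<in>carrier G. u (g \<otimes>\<^bsub>G\<^esub> h) = u g \<otimes>\<^bsub>multiplier B\<^esub> u h) \<and>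
     (\<forall>g\<in>carrier G. \<forall>d\<in>carrier D.
        \<pi> (\<alpha> g d) = u g \<otimes>\<^bsub>multiplier B\<^esub> \<pi> d \<otimes>\<^bsub>multiplier B\<^esub> star (multiplier B) (u g))"

text \<open>
  \<open>(A, i\<^sub>D, i\<^sub>G)\<close> is a full crossed product of the system \<open>(D, G, \<alpha>)\<close>: it is covariant, \<open>A\<close> is the
  closed span of the products \<open>i\<^sub>D(d) i\<^sub>G(g)\<close> (which lie in \<open>A\<close>, the group being discrete), and every
  covariant homomorphism into a multiplier algebra integrates to \<open>A\<close>.

  A quantifier over C*-algebras \<open>B\<close> has to name a type for their elements. The type
  \<^typ>\<open>nat \<Rightarrow> 'g \<Rightarrow> 'd\<close> is large enough to give the universal property for all C*-algebras: the closed
  span of \<open>\<pi>(D) u(G)\<close> is a C*-algebra, each of whose elements is the limit of a sequence of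
  finite sums \<open>\<Sum>\<^sub>g \<pi>(f g) u(g)\<close> with \<open>f :: 'g \<Rightarrow> 'd\<close>, so it has an isomorphic copy carried by a
  subset of that type, and \<open>B\<close> may be replaced by it.
\<close>

definition crossed_product ::
    "('d, 'm) cstar_alg_scheme \<Rightarrow> ('g, 'k) monoid_scheme \<Rightarrow> ('g \<Rightarrow> 'd \<Rightarrow> 'd) \<Rightarrow>
     ('a, 'n) cstar_alg_scheme \<Rightarrow> ('d \<Rightarrow> 'a dcent) \<Rightarrow> ('g \<Rightarrow> 'a dcent) \<Rightarrow> bool" where
  "crossed_product D G \<alpha> A iD iG \<longleftrightarrow>
     cstar_algebra A \<and>
     covariant_hom D G \<alpha> A iD iG \<and>
     closed_span (multiplier A)
       {iD d \<otimes>\<^bsub>multiplier A\<^esub> iG g | d g. d \<in> carrier D \<and> g \<in> carrier G}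
       = mult_embed A ` carrier A \<and>
     (\<forall>(B :: (nat \<Rightarrow> 'g \<Rightarrow> 'd) cstar_alg) \<pi> u.
        cstar_algebra B \<and> covariant_hom D G \<alpha> B \<pi> u \<longrightarrow>
        (\<exists>\<Phi>\<in>cstar_hom A (multiplier B). nondegenerate A B \<Phi> \<and>
           (\<forall>d\<in>carrier D. \<forall>g\<in>carrier G. \<forall>x\<in>carrier A.
              mult_embed A x = iD d \<otimes>\<^bsub>multiplier A\<^esub> iG g \<longrightarrow>
              \<Phi> x = \<pi> d \<otimes>\<^bsub>multiplier B\<^esub> u g)))"


section \<open>The semidirect product and its action\<close>

definition conj_set :: "('g, 'k) monoid_scheme \<Rightarrow> 'g \<Rightarrow> 'g set \<Rightarrow> 'g set" where
  "conj_set G a M = a <#\<^bsub>G\<^esub> M #>\<^bsub>G\<^esub> inv\<^bsub>G\<^esub> a"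

definition conj_family :: "('g, 'k) monoid_scheme \<Rightarrow> 'g set \<Rightarrow> 'g set \<Rightarrow> 'g set set" where
  "conj_family G H M = {conj_set G a M | a. a \<in> H}"

definition H_plus :: "('g, 'k) monoid_scheme \<Rightarrow> 'g set \<Rightarrow> 'g set \<Rightarrow> 'g set" where
  "H_plus G H M = {a \<in> H. conj_set G a M \<subseteq> M}"

locale semidirect_setting = group G for G (structure) and N H M :: "'a set" +
  assumes N_normal: "N \<lhd> G"
    and H_subgroup: "subgroup H G"
    and N_Int_H: "N \<inter> H = {\<one>}"
    and N_mult_H: "N <#> H = carrier G"
    and M_normal: "M \<lhd> (G\<lparr>carrier := N\<rparr>)"
    and M_nontrivial: "M \<noteq> {\<one>}"
    and filter_base: "\<lbrakk>U \<in> conj_family G H M; V \<in> conj_family G H M\<rbrakk>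
          \<Longrightarrow> \<exists>W\<in>conj_family G H M. W \<subseteq> U \<inter> V"
    and separating: "\<Inter>(conj_family G H M) = {\<one>}"
    and finite_quotients: "\<lbrakk>U \<in> conj_family G H M; V \<in> conj_family G H M; V \<subseteq> U\<rbrakk>
          \<Longrightarrow> finite (carrier (G\<lparr>carrier := U\<rparr> Mod V))"

definition NH_split :: "('g, 'k) monoid_scheme \<Rightarrow> 'g set \<Rightarrow> 'g set \<Rightarrow> 'g \<Rightarrow> 'g \<times> 'g" where
  "NH_split G N H g = (THE (x, a). x \<in> N \<and> a \<in> H \<and> g = x \<otimes>\<^bsub>G\<^esub> a)"

definition \<beta>_act :: "('g, 'k) monoid_scheme \<Rightarrow> 'g set \<Rightarrow> 'g set \<Rightarrow> 'g \<Rightarrow> 'g \<Rightarrow> 'g" where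
  "\<beta>_act G N H g y = (case NH_split G N H g of (x, a) \<Rightarrow> x \<otimes>\<^bsub>G\<^esub> a \<otimes>\<^bsub>G\<^esub> y \<otimes>\<^bsub>G\<^esub> inv\<^bsub>G\<^esub> a)"

text \<open>Functions on \<open>N\<close> are represented by functions on the whole type that vanish off \<open>N\<close>.\<close>

definition linfty :: "'g set \<Rightarrow> ('g \<Rightarrow> complex) cstar_alg" where
  "linfty N =
     \<lparr>carrier = {f. (\<forall>y. y \<notin> N \<longrightarrow> f y = 0) \<and> (\<exists>K. \<forall>y\<in>N. cmod (f y) \<le> K)},
      mult = (\<lambda>f h y. f y * h y),
      one = (\<lambda>y. if y \<in> N then 1 else 0),
      zero = (\<lambda>y. 0),
      add = (\<lambda>f h y. f y + h y),
      smult = (\<lambda>c f y. c * f y),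
      star = (\<lambda>f y. cnj (f y)),
      cnorm = (\<lambda>f. SUP y\<in>N. cmod (f y))\<rparr>"

definition charfun :: "'g set \<Rightarrow> 'g \<Rightarrow> complex" where
  "charfun S y = (if y \<in> S then 1 else 0)"

definition \<alpha>_act ::
    "('g, 'k) monoid_scheme \<Rightarrow> 'g set \<Rightarrow> 'g set \<Rightarrow> 'g \<Rightarrow> ('g \<Rightarrow> complex) \<Rightarrow> 'g \<Rightarrow> complex" where
  "\<alpha>_act G N H g f y = (if y \<in> N then f (\<beta>_act G N H (inv\<^bsub>G\<^esub> g) y) else 0)"

definition D_alg ::
    "('g, 'k) monoid_scheme \<Rightarrow> 'g set \<Rightarrow> 'g set \<Rightarrow> 'g set \<Rightarrow> ('g \<Rightarrow> complex) cstar_alg" where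
  "D_alg G N H M = (linfty N)\<lparr>carrier :=
     cstar_generated (linfty N)
       {charfun (x <#\<^bsub>G\<^esub> U) | x U. x \<in> N \<and> U \<in> conj_family G H M}\<rparr>"


section \<open>SU-families\<close>

text \<open>
  In the third relation \<open>r\<close> chooses a representative of each coset; the relation is required for
  every choice.
\<close>

definition SU_family ::
    "('g, 'k) monoid_scheme \<Rightarrow> 'g set \<Rightarrow> 'g set \<Rightarrow> ('b, 'm) cstar_alg_scheme \<Rightarrow>
     ('g \<Rightarrow> 'b) \<Rightarrow> ('g \<Rightarrow> 'b) \<Rightarrow> bool" where
  "SU_family G H M B S U \<longleftrightarrow>
     unital_cstar_algebra B \<and>
     (\<forall>a\<in>H_plus G H M. cisometry B (S a)) \<and>
     (\<forall>m\<in>M. cunitary B (U m)) \<and>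
     (\<forall>a\<in>H_plus G H M. \<forall>b\<in>H_plus G H M. S a \<otimes>\<^bsub>B\<^esub> S b = S (a \<otimes>\<^bsub>G\<^esub> b)) \<and>
     (\<forall>a\<in>H_plus G H M. \<forall>m\<in>M.
        S a \<otimes>\<^bsub>B\<^esub> U m = U (a \<otimes>\<^bsub>G\<^esub> m \<otimes>\<^bsub>G\<^esub> inv\<^bsub>G\<^esub> a) \<otimes>\<^bsub>B\<^esub> S a) \<and>
     (\<forall>a\<in>H_plus G H M. \<forall>r.
        (\<forall>C\<in>lcosets\<^bsub>G\<lparr>carrier := M\<rparr>\<^esub> (conj_set G a M). r C \<in> C) \<longrightarrow>
        (\<Oplus>\<^bsub>B\<^esub>C\<in>lcosets\<^bsub>G\<lparr>carrier := M\<rparr>\<^esub> (conj_set G a M).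
           U (r C) \<otimes>\<^bsub>B\<^esub> S a \<otimes>\<^bsub>B\<^esub> star B (S a) \<otimes>\<^bsub>B\<^esub> U (inv\<^bsub>G\<^esub> (r C))) = \<one>\<^bsub>B\<^esub>) \<and>
     (\<forall>m\<in>M. \<forall>k\<in>M. U m \<otimes>\<^bsub>B\<^esub> U k = U (m \<otimes>\<^bsub>G\<^esub> k))"

end

theory Submission
  imports Defs
begin

text \<open>
  Everything takes place in the multiplier algebra of \<open>A\<close>, a unital C*-algebra in which \<open>A\<close> sits as a
  closed *-ideal. Covariance turns translation of cosets into conjugation: for \<open>g = x a\<close> with
  \<open>x \<in> N\<close>, \<open>a \<in> H\<close>, the element \<open>g p g\<^sup>-\<^sup>1\<close> is the characteristic function of \<open>x a M a\<^sup>-\<^sup>1\<close>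
  (\<open>iD_coset\<close>). For \<open>a \<in> H\<^sup>+\<close> this gives \<open>a p a\<^sup>-\<^sup>1 \<le> p\<close>, that is \<open>p a p = a p\<close>, and an \<open>m \<in> M\<close> commutes
  with \<open>p\<close> because \<open>m M = M\<close>. So \<open>s\<^sub>a = a p\<close> and \<open>u(m) = m p = p m\<close>, and the relations of an
  SU-family become computations with words in \<open>p\<close> and group elements; the summation relation
  expresses that \<open>M\<close> is the disjoint union of the cosets of \<open>a M a\<^sup>-\<^sup>1\<close>.

  For generation, \<open>A\<close> is the closed span of the products \<open>d g\<close>, and since \<open>D\<close> is commutative
  \<open>p d g p = (p d p) (p g p)\<close>. It is enough to reach both factors. For \<open>p g p\<close>, the assumptions on \<open>H\<close>
  and \<open>N\<close> allow one to write \<open>g = e\<^sup>-\<^sup>1 m f\<close> with \<open>e, f \<in> H\<^sup>+\<close> and \<open>m \<in> M\<close> (\<open>factorisation\<close>), whence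
  \<open>p g p = s\<^sub>e\<^sup>* u(m) s\<^sub>f\<close>. For \<open>p d p\<close>, the functions \<open>d\<close> that compress into the generated algebra
  form a C*-subalgebra of \<open>D\<close>, so \<open>d\<close> may be taken to be the characteristic function of \<open>x U\<close>. As quotients are
  finite, \<open>x U\<close> is a finite union of cosets of some \<open>c M c\<^sup>-\<^sup>1\<close> with \<open>c \<in> H\<^sup>+\<close>, and each of these
  is disjoint from \<open>M\<close> or has characteristic function \<open>u(m) s\<^sub>c s\<^sub>c\<^sup>* u(m)\<^sup>*\<close>.

  Two analytic facts carry the argument. The multiplier algebra is a C*-algebra; all
  verifications reduce to the single identity \<open>R(x) y = x L(y)\<close>, since a C*-algebra has no
  annihilators. And passing to limits in \<open>D\<close> requires that a *-homomorphism \<open>\<phi>\<close> on an algebra of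
  functions is bounded: a real function \<open>d\<close> with \<open>\<bar>d\<bar> \<le> 1/2\<close> is the real part of the
  unimodular function \<open>d + i sqrt (1 - d\<^sup>2)\<close>, so that \<open>\<phi>(d)\<close> is the real part of an
  isometry and has norm at most \<open>1\<close>.
\<close>

section \<open>Elementary facts about C*-algebras\<close>

context cstar_algebra
begin

lemma smult_zero_left: "x \<in> carrier A \<Longrightarrow> 0 \<odot> x = \<zero>"
  using smult_add_left[of x 0 0] smult_closed[of x 0] by simp

lemma a_inv_eq_smult: "x \<in> carrier A \<Longrightarrow> \<ominus> x = (-1) \<odot> x"
  using smult_add_left[of x "-1" 1] smult_closed[of x "-1"]
  by (intro minus_equality) (auto simp: smult_one smult_zero_left)

lemma mult_zero_left: "x \<in> carrier A \<Longrightarrow> \<zero> \<otimes> x = \<zero>"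
  using smult_mult_left[of \<zero> x 0] mult_closed[of \<zero> x] by (simp add: smult_zero_left)

lemma mult_zero_right: "x \<in> carrier A \<Longrightarrow> x \<otimes> \<zero> = \<zero>"
  using smult_mult_right[of x \<zero> 0] mult_closed[of x \<zero>] by (simp add: smult_zero_left)

lemma minus_eq_smult: "\<lbrakk>x \<in> carrier A; y \<in> carrier A\<rbrakk> \<Longrightarrow> x \<ominus> y = x \<oplus> (-1) \<odot> y"
  by (simp add: a_minus_def a_inv_eq_smult)

lemma diff_mult_distrib:
  "\<lbrakk>x \<in> carrier A; y \<in> carrier A; z \<in> carrier A\<rbrakk> \<Longrightarrow> (x \<ominus> y) \<otimes> z = x \<otimes> z \<ominus> y \<otimes> z"
  by (simp add: minus_eq_smult smult_closed mult_closed distrib_right smult_mult_left)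

lemma mult_diff_distrib:
  "\<lbrakk>x \<in> carrier A; y \<in> carrier A; z \<in> carrier A\<rbrakk> \<Longrightarrow> z \<otimes> (x \<ominus> y) = z \<otimes> x \<ominus> z \<otimes> y"
  by (simp add: minus_eq_smult smult_closed mult_closed distrib_left smult_mult_right)

lemma norm_zero: "cnorm A \<zero> = 0"
  by (simp add: norm_eq_0_iff)

lemma norm_uminus: "x \<in> carrier A \<Longrightarrow> cnorm A (\<ominus> x) = cnorm A x"
  by (simp add: a_inv_eq_smult norm_smult)

lemma norm_minus_commute:
  "\<lbrakk>x \<in> carrier A; y \<in> carrier A\<rbrakk> \<Longrightarrow> cnorm A (x \<ominus> y) = cnorm A (y \<ominus> x)"
  using norm_uminus[of "x \<ominus> y"] by (simp add: a_minus_def minus_add a_comm)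

lemma diff_eq_zero_iff: "\<lbrakk>x \<in> carrier A; y \<in> carrier A\<rbrakk> \<Longrightarrow> x \<ominus> y = \<zero> \<longleftrightarrow> x = y"
  by (metis a_minus_def add.inv_solve_right' l_zero r_neg zero_closed)

lemma norm_diff_triangle:
  assumes "x \<in> carrier A" "y \<in> carrier A" "z \<in> carrier A"
  shows "cnorm A (x \<ominus> z) \<le> cnorm A (x \<ominus> y) + cnorm A (y \<ominus> z)"
proof -
  have "x \<ominus> z = (x \<ominus> y) \<oplus> (y \<ominus> z)"
    using assms by (simp add: a_minus_def a_assoc r_neg1 r_neg2)
  then show ?thesis using norm_triangle[of "x \<ominus> y" "y \<ominus> z"] assms by simp
qed

lemma norm_le_norm_diff:
  assumes "x \<in> carrier A" "y \<in> carrier A"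
  shows "cnorm A x \<le> cnorm A y + cnorm A (x \<ominus> y)"
proof -
  have "x = y \<oplus> (x \<ominus> y)"
    using assms by (simp add: a_minus_def a_lcomm r_neg)
  then show ?thesis using norm_triangle[of y "x \<ominus> y"] assms by simp
qed

lemma norm_star: assumes "x \<in> carrier A" shows "cnorm A (star A x) = cnorm A x"
proof -
  have le: "cnorm A y \<le> cnorm A (star A y)" if "y \<in> carrier A" for y
  proof (cases "cnorm A y = 0")
    case True
    then show ?thesis using norm_nonneg star_closed that by simp
  next
    case False
    have "(cnorm A y)\<^sup>2 \<le> cnorm A (star A y) * cnorm A y"
      using cstar_identity[OF that] norm_mult[OF star_closed[OF that] that] by simp
    then show ?thesis using False norm_nonneg[OF that] by (simp add: power2_eq_square)
  qed
  show ?thesis using le[OF assms] le[OF star_closed[OF assms]] star_star[OF assms] by simp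
qed

text \<open>
  By the C*-identity a C*-algebra has no annihilators: \<open>x x* = 0\<close> forces \<open>x = 0\<close>. So an element is
  determined by how it multiplies the others, from either side.
\<close>

lemma mult_right_faithful:
  assumes "x \<in> carrier A" "y \<in> carrier A" and eq: "\<And>z. z \<in> carrier A \<Longrightarrow> x \<otimes> z = y \<otimes> z"
  shows "x = y"
proof -
  let ?d = "x \<ominus> y"
  have d: "?d \<in> carrier A" using assms by simp
  have "?d \<otimes> star A ?d = \<zero>"
    using assms d by (simp add: diff_mult_distrib star_closed mult_closed diff_eq_zero_iff)
  then have "(cnorm A (star A ?d))\<^sup>2 = 0"
    using cstar_identity[OF star_closed[OF d]] d by (simp add: star_star norm_zero)
  then have "?d = \<zero>" using d by (simp add: norm_star norm_eq_0_iff)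
  then show ?thesis using assms by (simp add: diff_eq_zero_iff)
qed

lemma mult_left_faithful:
  assumes "x \<in> carrier A" "y \<in> carrier A" and eq: "\<And>z. z \<in> carrier A \<Longrightarrow> z \<otimes> x = z \<otimes> y"
  shows "x = y"
proof -
  have "star A x = star A y"
  proof (rule mult_right_faithful)
    fix z assume z: "z \<in> carrier A"
    have "star A w \<otimes> z = star A (star A z \<otimes> w)" if "w \<in> carrier A" for w
      using z that by (simp add: star_mult star_closed star_star)
    then show "star A x \<otimes> z = star A y \<otimes> z" using eq star_closed[OF z] assms(1,2) by simp
  qed (use assms star_closed in auto)
  then show ?thesis using star_star assms by metis
qed

lemma cconv_dominated:
  assumes "\<And>n. X n \<in> carrier A" "x \<in> carrier A" "(\<lambda>n. b n) \<longlonglongrightarrow> (0::real)"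
    "\<And>n. cnorm A (X n \<ominus> x) \<le> b n"
  shows "cconv A X x"
  unfolding cconv_def
  by (rule tendsto_sandwich[OF _ _ tendsto_const assms(3)]) (use assms in \<open>auto simp: norm_nonneg\<close>)

lemma cconv_mult_left:
  assumes "\<And>n. X n \<in> carrier A" "x \<in> carrier A" "cconv A X x" "z \<in> carrier A"
  shows "cconv A (\<lambda>n. z \<otimes> X n) (z \<otimes> x)"
proof (rule cconv_dominated)
  show "(\<lambda>n. cnorm A z * cnorm A (X n \<ominus> x)) \<longlonglongrightarrow> 0"
    using tendsto_mult_right_zero[OF assms(3)[unfolded cconv_def]] by simp
qed (use assms in \<open>auto simp: mult_closed mult_diff_distrib[symmetric] norm_mult\<close>)

lemma cconv_mult_right:
  assumes "\<And>n. X n \<in> carrier A" "x \<in> carrier A" "cconv A X x" "z \<in> carrier A"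
  shows "cconv A (\<lambda>n. X n \<otimes> z) (x \<otimes> z)"
proof (rule cconv_dominated)
  show "(\<lambda>n. cnorm A (X n \<ominus> x) * cnorm A z) \<longlonglongrightarrow> 0"
    using tendsto_mult_left_zero[OF assms(3)[unfolded cconv_def]] by simp
qed (use assms in \<open>auto simp: mult_closed diff_mult_distrib[symmetric] norm_mult\<close>)

lemma cconv_unique:
  assumes "\<And>n. X n \<in> carrier A" "x \<in> carrier A" "cconv A X x" "y \<in> carrier A" "cconv A X y"
  shows "x = y"
proof -
  have "(\<lambda>n. cnorm A (X n \<ominus> x) + cnorm A (X n \<ominus> y)) \<longlonglongrightarrow> 0"
    using tendsto_add[OF assms(3,5)[unfolded cconv_def]] by simp
  moreover have "cnorm A (x \<ominus> y) \<le> cnorm A (X n \<ominus> x) + cnorm A (X n \<ominus> y)" for n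
    using norm_diff_triangle[of x "X n" y] norm_minus_commute[of x "X n"] assms by simp
  ultimately have "cnorm A (x \<ominus> y) \<le> 0" by (intro LIMSEQ_le_const) auto
  then have "cnorm A (x \<ominus> y) = 0" using norm_nonneg[of "x \<ominus> y"] assms by simp
  then show ?thesis using assms by (simp add: norm_eq_0_iff diff_eq_zero_iff)
qed

end

section \<open>The multiplier algebra is a C*-algebra\<close>

context cstar_algebra
begin

lemma multiplier_sel [simp]:
  "carrier (multiplier A) = double_centralisers A"
  "\<And>a. a \<in> carrier A \<Longrightarrow> fst (\<zero>\<^bsub>multiplier A\<^esub>) a = \<zero>"
  "\<And>a. a \<in> carrier A \<Longrightarrow> snd (\<zero>\<^bsub>multiplier A\<^esub>) a = \<zero>"
  "\<And>a. a \<in> carrier A \<Longrightarrow> fst (\<one>\<^bsub>multiplier A\<^esub>) a = a"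
  "\<And>a. a \<in> carrier A \<Longrightarrow> snd (\<one>\<^bsub>multiplier A\<^esub>) a = a"
  "\<And>a S T. a \<in> carrier A \<Longrightarrow> fst (S \<otimes>\<^bsub>multiplier A\<^esub> T) a = fst S (fst T a)"
  "\<And>a S T. a \<in> carrier A \<Longrightarrow> snd (S \<otimes>\<^bsub>multiplier A\<^esub> T) a = snd T (snd S a)"
  "\<And>a S T. a \<in> carrier A \<Longrightarrow> fst (S \<oplus>\<^bsub>multiplier A\<^esub> T) a = fst S a \<oplus> fst T a"
  "\<And>a S T. a \<in> carrier A \<Longrightarrow> snd (S \<oplus>\<^bsub>multiplier A\<^esub> T) a = snd S a \<oplus> snd T a"
  "\<And>a c T. a \<in> carrier A \<Longrightarrow> fst (c \<odot>\<^bsub>multiplier A\<^esub> T) a = c \<odot> fst T a"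
  "\<And>a c T. a \<in> carrier A \<Longrightarrow> snd (c \<odot>\<^bsub>multiplier A\<^esub> T) a = c \<odot> snd T a"
  "\<And>a T. a \<in> carrier A \<Longrightarrow> fst (star (multiplier A) T) a = star A (snd T (star A a))"
  "\<And>a T. a \<in> carrier A \<Longrightarrow> snd (star (multiplier A) T) a = star A (fst T (star A a))"
  "\<And>a x. a \<in> carrier A \<Longrightarrow> fst (mult_embed A x) a = x \<otimes> a"
  "\<And>a x. a \<in> carrier A \<Longrightarrow> snd (mult_embed A x) a = a \<otimes> x"
  by (auto simp: multiplier_def mult_embed_def split_beta)

lemma multiplier_extensional:
  "fst (\<zero>\<^bsub>multiplier A\<^esub>) \<in> extensional (carrier A)"
  "snd (\<zero>\<^bsub>multiplier A\<^esub>) \<in> extensional (carrier A)"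
  "fst (\<one>\<^bsub>multiplier A\<^esub>) \<in> extensional (carrier A)"
  "snd (\<one>\<^bsub>multiplier A\<^esub>) \<in> extensional (carrier A)"
  "fst (S \<otimes>\<^bsub>multiplier A\<^esub> T) \<in> extensional (carrier A)"
  "snd (S \<otimes>\<^bsub>multiplier A\<^esub> T) \<in> extensional (carrier A)"
  "fst (S \<oplus>\<^bsub>multiplier A\<^esub> T) \<in> extensional (carrier A)"
  "snd (S \<oplus>\<^bsub>multiplier A\<^esub> T) \<in> extensional (carrier A)"
  "fst (c \<odot>\<^bsub>multiplier A\<^esub> T) \<in> extensional (carrier A)"
  "snd (c \<odot>\<^bsub>multiplier A\<^esub> T) \<in> extensional (carrier A)"
  "fst (star (multiplier A) T) \<in> extensional (carrier A)"
  "snd (star (multiplier A) T) \<in> extensional (carrier A)"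
  "fst (mult_embed A x) \<in> extensional (carrier A)"
  "snd (mult_embed A x) \<in> extensional (carrier A)"
  by (auto simp: multiplier_def mult_embed_def split_beta)

lemma double_centralisersD:
  assumes "T \<in> double_centralisers A"
  shows "\<And>x. x \<in> carrier A \<Longrightarrow> fst T x \<in> carrier A"
    and "\<And>x. x \<in> carrier A \<Longrightarrow> snd T x \<in> carrier A"
    and "fst T \<in> extensional (carrier A)"
    and "snd T \<in> extensional (carrier A)"
    and "\<And>x y. \<lbrakk>x \<in> carrier A; y \<in> carrier A\<rbrakk> \<Longrightarrow> fst T (x \<oplus> y) = fst T x \<oplus> fst T y"
    and "\<And>c x. x \<in> carrier A \<Longrightarrow> fst T (c \<odot> x) = c \<odot> fst T x"
    and "\<And>x y. \<lbrakk>x \<in> carrier A; y \<in> carrier A\<rbrakk> \<Longrightarrow> fst T (x \<otimes> y) = fst T x \<otimes> y"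
    and "\<And>x y. \<lbrakk>x \<in> carrier A; y \<in> carrier A\<rbrakk> \<Longrightarrow> snd T x \<otimes> y = x \<otimes> fst T y"
    and "\<exists>K\<ge>0. \<forall>x\<in>carrier A. cnorm A (fst T x) \<le> K * cnorm A x"
proof -
  obtain L R where T: "T = (L, R)" by (cases T)
  note dc = assms[unfolded T double_centralisers_def bounded_lin_map_def]
  show "\<exists>K\<ge>0. \<forall>x\<in>carrier A. cnorm A (fst T x) \<le> K * cnorm A x"
  proof -
    obtain K where K: "\<forall>x\<in>carrier A. cnorm A (L x) \<le> K * cnorm A x" using dc by blast
    have "cnorm A (L x) \<le> \<bar>K\<bar> * cnorm A x" if "x \<in> carrier A" for x
      using K that mult_right_mono[OF abs_ge_self[of K] norm_nonneg[OF that]] by fastforce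
    then show ?thesis using T by (intro exI[of _ "\<bar>K\<bar>"]) auto
  qed
qed (use assms in \<open>auto simp: double_centralisers_def bounded_lin_map_def PiE_def Pi_def\<close>)

text \<open>
  Since multiplication is faithful, the single identity \<open>R(x) y = x L(y)\<close> already forces \<open>L\<close> and
  \<open>R\<close> to be linear and to be module maps, and \<open>R\<close> to obey the same norm bound as \<open>L\<close>.
\<close>

lemma snd_norm_bound:
  assumes LR: "\<And>x. x \<in> carrier A \<Longrightarrow> L x \<in> carrier A" "\<And>x. x \<in> carrier A \<Longrightarrow> R x \<in> carrier A"
    and adj: "\<And>x y. \<lbrakk>x \<in> carrier A; y \<in> carrier A\<rbrakk> \<Longrightarrow> R x \<otimes> y = x \<otimes> L y"
    and K: "\<And>x. x \<in> carrier A \<Longrightarrow> cnorm A (L x) \<le> K * cnorm A x" "0 \<le> K"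
    and x: "x \<in> carrier A"
  shows "cnorm A (R x) \<le> K * cnorm A x"
proof (cases "cnorm A (R x) = 0")
  case True
  then show ?thesis using K x norm_nonneg[OF x] by simp
next
  case False
  have Rx: "R x \<in> carrier A" and sR: "star A (R x) \<in> carrier A"
    using LR(2)[OF x] star_closed by auto
  have "(cnorm A (R x))\<^sup>2 = cnorm A (R x \<otimes> star A (R x))"
    using cstar_identity[OF sR] Rx by (simp add: star_star norm_star)
  also have "\<dots> = cnorm A (x \<otimes> L (star A (R x)))" using adj[OF x sR] by simp
  also have "\<dots> \<le> cnorm A x * cnorm A (L (star A (R x)))" using norm_mult x LR sR by simp
  also have "\<dots> \<le> cnorm A x * (K * cnorm A (R x))"
    using K(1)[OF sR] norm_star[OF Rx] norm_nonneg[OF x] by (simp add: mult_left_mono)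
  finally have "cnorm A (R x) * cnorm A (R x) \<le> (K * cnorm A x) * cnorm A (R x)"
    by (simp add: power2_eq_square mult_ac)
  then show ?thesis using False norm_nonneg[OF Rx] by simp
qed

lemma double_centralisersI:
  assumes LR: "\<And>x. x \<in> carrier A \<Longrightarrow> fst T x \<in> carrier A" "\<And>x. x \<in> carrier A \<Longrightarrow> snd T x \<in> carrier A"
    and ext: "fst T \<in> extensional (carrier A)" "snd T \<in> extensional (carrier A)"
    and adj: "\<And>x y. \<lbrakk>x \<in> carrier A; y \<in> carrier A\<rbrakk> \<Longrightarrow> snd T x \<otimes> y = x \<otimes> fst T y"
    and K: "\<And>x. x \<in> carrier A \<Longrightarrow> cnorm A (fst T x) \<le> K * cnorm A x" "0 \<le> K"
  shows "T \<in> double_centralisers A"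
proof -
  obtain L R where T: "T = (L, R)" by (cases T)
  note LR = LR[unfolded T, simplified] and adj = adj[unfolded T, simplified] and K = K[unfolded T, simplified]
  have adj': "x \<otimes> L y = R x \<otimes> y" if "x \<in> carrier A" "y \<in> carrier A" for x y using adj that by simp
  have "L (x \<oplus> y) = L x \<oplus> L y" if "x \<in> carrier A" "y \<in> carrier A" for x y
    by (rule mult_left_faithful) (use that in \<open>simp_all add: LR adj' distrib_left\<close>)
  moreover have "L (c \<odot> x) = c \<odot> L x" if "x \<in> carrier A" for c x
    by (rule mult_left_faithful) (use that in \<open>simp_all add: LR adj' smult_mult_right smult_closed\<close>)
  moreover have "L (x \<otimes> y) = L x \<otimes> y" if "x \<in> carrier A" "y \<in> carrier A" for x y
    by (rule mult_left_faithful)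
      (use that in \<open>simp_all add: LR adj' mult_assoc[symmetric] mult_closed\<close>)
  moreover have "R (x \<oplus> y) = R x \<oplus> R y" if "x \<in> carrier A" "y \<in> carrier A" for x y
    by (rule mult_right_faithful) (use that in \<open>simp_all add: LR adj distrib_right\<close>)
  moreover have "R (c \<odot> x) = c \<odot> R x" if "x \<in> carrier A" for c x
    by (rule mult_right_faithful) (use that in \<open>simp_all add: LR adj smult_mult_left smult_closed\<close>)
  moreover have "R (x \<otimes> y) = x \<otimes> R y" if "x \<in> carrier A" "y \<in> carrier A" for x y
    by (rule mult_right_faithful) (use that in \<open>simp_all add: LR adj mult_assoc mult_closed\<close>)
  moreover have "\<exists>K. \<forall>x\<in>carrier A. cnorm A (L x) \<le> K * cnorm A x"
    using K(1) by blast
  moreover have "\<exists>K. \<forall>x\<in>carrier A. cnorm A (R x) \<le> K * cnorm A x"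
    using snd_norm_bound[of L R K] LR adj K by blast
  ultimately show ?thesis
    using LR ext adj K unfolding T double_centralisers_def bounded_lin_map_def PiE_def Pi_def
    by auto
qed

lemma double_centralisers_eqI:
  assumes T: "T \<in> double_centralisers A" and S: "S \<in> double_centralisers A"
    and eq: "\<And>x. x \<in> carrier A \<Longrightarrow> fst T x = fst S x"
  shows "T = S"
proof -
  note TD = double_centralisersD[OF T] and SD = double_centralisersD[OF S]
  have "snd T x = snd S x" if x: "x \<in> carrier A" for x
    by (rule mult_right_faithful) (use x in \<open>simp_all add: TD SD eq\<close>)
  then show ?thesis
    using eq TD(3,4) SD(3,4) by (auto simp: prod_eq_iff intro: extensionalityI)
qed

lemma multiplier_ops_closed:
  shows "\<zero>\<^bsub>multiplier A\<^esub> \<in> double_centralisers A"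
    and "\<one>\<^bsub>multiplier A\<^esub> \<in> double_centralisers A"
    and "\<lbrakk>S \<in> double_centralisers A; T \<in> double_centralisers A\<rbrakk> \<Longrightarrow> S \<oplus>\<^bsub>multiplier A\<^esub> T \<in> double_centralisers A"
    and "\<lbrakk>S \<in> double_centralisers A; T \<in> double_centralisers A\<rbrakk> \<Longrightarrow> S \<otimes>\<^bsub>multiplier A\<^esub> T \<in> double_centralisers A"
    and "T \<in> double_centralisers A \<Longrightarrow> c \<odot>\<^bsub>multiplier A\<^esub> T \<in> double_centralisers A"
    and "T \<in> double_centralisers A \<Longrightarrow> star (multiplier A) T \<in> double_centralisers A"
    and "x \<in> carrier A \<Longrightarrow> mult_embed A x \<in> double_centralisers A"
proof -
  show "\<zero>\<^bsub>multiplier A\<^esub> \<in> double_centralisers A"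
    by (rule double_centralisersI[of _ 0]) (auto simp: multiplier_extensional mult_zero_left mult_zero_right norm_zero)
  show "\<one>\<^bsub>multiplier A\<^esub> \<in> double_centralisers A"
    by (rule double_centralisersI[of _ 1]) (auto simp: multiplier_extensional)
  show "mult_embed A x \<in> double_centralisers A" if "x \<in> carrier A"
    by (rule double_centralisersI[of _ "cnorm A x"])
      (use that in \<open>auto simp: multiplier_extensional mult_closed mult_assoc norm_mult norm_nonneg\<close>)
  {
    assume S: "S \<in> double_centralisers A" and T: "T \<in> double_centralisers A"
    note D = double_centralisersD[OF S] double_centralisersD[OF T]
    obtain K where K: "K \<ge> 0" "\<And>x. x \<in> carrier A \<Longrightarrow> cnorm A (fst S x) \<le> K * cnorm A x"
      using D(9) by blast
    obtain J where J: "J \<ge> 0" "\<And>x. x \<in> carrier A \<Longrightarrow> cnorm A (fst T x) \<le> J * cnorm A x"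
      using D(18) by blast
    show "S \<oplus>\<^bsub>multiplier A\<^esub> T \<in> double_centralisers A"
    proof (rule double_centralisersI[of _ "K + J"])
      fix x assume x: "x \<in> carrier A"
      show "cnorm A (fst (S \<oplus>\<^bsub>multiplier A\<^esub> T) x) \<le> (K + J) * cnorm A x"
        using x K(2)[OF x] J(2)[OF x] norm_triangle[of "fst S x" "fst T x"] D(1,10)
        by (simp add: ring_distribs)
    qed (use D K J in \<open>auto simp: multiplier_extensional distrib_left distrib_right\<close>)
    show "S \<otimes>\<^bsub>multiplier A\<^esub> T \<in> double_centralisers A"
    proof (rule double_centralisersI[of _ "K * J"])
      fix x assume x: "x \<in> carrier A"
      show "cnorm A (fst (S \<otimes>\<^bsub>multiplier A\<^esub> T) x) \<le> (K * J) * cnorm A x"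
        using x K(2)[of "fst T x"] mult_left_mono[OF J(2)[OF x] K(1)] D
        by (simp add: mult_ac)
    qed (use D K J in \<open>auto simp: multiplier_extensional\<close>)
  }
  {
    assume T: "T \<in> double_centralisers A"
    note D = double_centralisersD[OF T]
    obtain K where K: "K \<ge> 0" "\<And>x. x \<in> carrier A \<Longrightarrow> cnorm A (fst T x) \<le> K * cnorm A x"
      using D(9) by blast
    show "c \<odot>\<^bsub>multiplier A\<^esub> T \<in> double_centralisers A"
    proof (rule double_centralisersI[of _ "cmod c * K"])
      fix x assume x: "x \<in> carrier A"
      show "cnorm A (fst (c \<odot>\<^bsub>multiplier A\<^esub> T) x) \<le> (cmod c * K) * cnorm A x"
        using x mult_left_mono[OF K(2)[OF x], of "cmod c"] D by (simp add: norm_smult mult_ac)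
    qed (use D K in \<open>auto simp: multiplier_extensional smult_closed smult_mult_left smult_mult_right\<close>)
    have bound: "cnorm A (snd T (star A x)) \<le> K * cnorm A x" if "x \<in> carrier A" for x
      using snd_norm_bound[of "fst T" "snd T" K "star A x"] D K star_closed[OF that]
      by (simp add: norm_star that)
    show "star (multiplier A) T \<in> double_centralisers A"
    proof (rule double_centralisersI[of _ K])
      fix x y assume x: "x \<in> carrier A" and y: "y \<in> carrier A"
      have "star A (star A y \<otimes> fst T (star A x)) = star A (snd T (star A y) \<otimes> star A x)"
        using x y D(8)[of "star A y" "star A x"] by (simp add: star_closed)
      moreover have "star A (star A y \<otimes> fst T (star A x)) = star A (fst T (star A x)) \<otimes> y"
        and "star A (snd T (star A y) \<otimes> star A x) = x \<otimes> star A (snd T (star A y))"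
        using x y by (simp_all add: star_mult star_closed star_star D(1,2))
      ultimately show "snd (star (multiplier A) T) x \<otimes> y = x \<otimes> fst (star (multiplier A) T) y"
        using x y by simp
    qed (use D K bound in \<open>auto simp: multiplier_extensional star_closed norm_star bound\<close>)
  }
qed

lemma abelian_group_multiplier: "abelian_group (multiplier A)"
proof (rule abelian_groupI)
  show "\<exists>S\<in>carrier (multiplier A). S \<oplus>\<^bsub>multiplier A\<^esub> T = \<zero>\<^bsub>multiplier A\<^esub>"
    if T: "T \<in> carrier (multiplier A)" for T
  proof
    have T': "T \<in> double_centralisers A" using T by simp
    show mT: "(-1) \<odot>\<^bsub>multiplier A\<^esub> T \<in> carrier (multiplier A)"
      using T by (simp add: multiplier_ops_closed)
    show "(-1) \<odot>\<^bsub>multiplier A\<^esub> T \<oplus>\<^bsub>multiplier A\<^esub> T = \<zero>\<^bsub>multiplier A\<^esub>"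
    proof (rule double_centralisers_eqI)
      fix x assume x: "x \<in> carrier A"
      then show "fst ((-1) \<odot>\<^bsub>multiplier A\<^esub> T \<oplus>\<^bsub>multiplier A\<^esub> T) x = fst \<zero>\<^bsub>multiplier A\<^esub> x"
        using double_centralisersD(1)[OF T'] by (simp add: a_inv_eq_smult[symmetric] l_neg)
    qed (use mT T' in \<open>simp_all add: multiplier_ops_closed\<close>)
  qed
qed ((rule double_centralisers_eqI; simp add: multiplier_ops_closed double_centralisersD(1) a_ac)
     | simp add: multiplier_ops_closed)+

lemma multiplier_diff:
  assumes S: "S \<in> double_centralisers A" and T: "T \<in> double_centralisers A"
  shows "S \<ominus>\<^bsub>multiplier A\<^esub> T \<in> double_centralisers A"
    and "\<And>x. x \<in> carrier A \<Longrightarrow> fst (S \<ominus>\<^bsub>multiplier A\<^esub> T) x = fst S x \<ominus> fst T x"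
    and "\<And>x. x \<in> carrier A \<Longrightarrow> snd (S \<ominus>\<^bsub>multiplier A\<^esub> T) x = snd S x \<ominus> snd T x"
proof -
  interpret M: abelian_group "multiplier A" by (rule abelian_group_multiplier)
  let ?D = "S \<ominus>\<^bsub>multiplier A\<^esub> T"
  show D: "?D \<in> double_centralisers A" using M.minus_closed[of S T] S T by simp
  have sum: "?D \<oplus>\<^bsub>multiplier A\<^esub> T = S"
    using S T M.a_inv_closed[of T] M.a_assoc[of S "\<ominus>\<^bsub>multiplier A\<^esub> T" T] M.l_neg[of T] M.r_zero[of S]
    by (simp add: a_minus_def)
  fix x assume x: "x \<in> carrier A"
  have *: "d = e \<ominus> f" if "d \<oplus> f = e" "d \<in> carrier A" "e \<in> carrier A" "f \<in> carrier A" for d e f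
    using that by (auto simp: a_minus_def a_assoc r_neg)
  show "fst ?D x = fst S x \<ominus> fst T x"
    using *[of "fst ?D x" "fst T x"] arg_cong[OF sum, of "\<lambda>X. fst X x"] x double_centralisersD(1)[OF D]
      double_centralisersD(1)[OF S] double_centralisersD(1)[OF T] by simp
  show "snd ?D x = snd S x \<ominus> snd T x"
    using *[of "snd ?D x" "snd T x"] arg_cong[OF sum, of "\<lambda>X. snd X x"] x double_centralisersD(2)[OF D]
      double_centralisersD(2)[OF S] double_centralisersD(2)[OF T] by simp
qed

lemma multiplier_norm_least:
  assumes "\<And>x. x \<in> carrier A \<Longrightarrow> cnorm A (fst T x) \<le> K * cnorm A x" "0 \<le> K"
  shows "cnorm (multiplier A) T \<le> K"
proof -
  have "(SUP x\<in>{x \<in> carrier A. cnorm A x \<le> 1}. cnorm A (fst T x)) \<le> K"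
  proof (rule cSUP_least)
    show "{x \<in> carrier A. cnorm A x \<le> 1} \<noteq> {}" using norm_zero by auto
    fix x assume "x \<in> {x \<in> carrier A. cnorm A x \<le> 1}"
    then show "cnorm A (fst T x) \<le> K"
      using assms(1)[of x] mult_left_mono[of "cnorm A x" 1 K] assms(2) by force
  qed
  then show ?thesis by (simp add: multiplier_def split_beta)
qed

lemma multiplier_norm_bound:
  assumes T: "T \<in> double_centralisers A" and x: "x \<in> carrier A"
  shows "cnorm A (fst T x) \<le> cnorm (multiplier A) T * cnorm A x"
proof -
  note D = double_centralisersD[OF T]
  obtain K where K: "K \<ge> 0" "\<And>x. x \<in> carrier A \<Longrightarrow> cnorm A (fst T x) \<le> K * cnorm A x"
    using D(9) by blast
  have bdd: "bdd_above ((\<lambda>x. cnorm A (fst T x)) ` {x \<in> carrier A. cnorm A x \<le> 1})"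
  proof (rule bdd_aboveI2)
    fix x assume "x \<in> {x \<in> carrier A. cnorm A x \<le> 1}"
    then show "cnorm A (fst T x) \<le> K"
      using K(2)[of x] mult_left_mono[of "cnorm A x" 1 K] K(1) by force
  qed
  have unit: "cnorm A (fst T y) \<le> cnorm (multiplier A) T" if "y \<in> carrier A" "cnorm A y \<le> 1" for y
    using cSUP_upper[OF _ bdd, of y] that by (simp add: multiplier_def split_beta)
  show ?thesis
  proof (cases "x = \<zero>")
    case True
    then show ?thesis using K(2)[OF x] by (simp add: norm_zero)
  next
    case False
    then have pos: "cnorm A x > 0" using norm_nonneg[OF x] norm_eq_0_iff[OF x] by linarith
    define y where "y = complex_of_real (inverse (cnorm A x)) \<odot> x"
    have y: "y \<in> carrier A" "cnorm A y \<le> 1"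
      using x pos by (auto simp: y_def smult_closed norm_smult norm_inverse)
    have "cnorm A (fst T y) = inverse (cnorm A x) * cnorm A (fst T x)"
      using x pos D(1)[OF x] by (simp add: y_def D(6) norm_smult norm_inverse)
    then show ?thesis using mult_left_mono[OF unit[OF y], of "cnorm A x"] pos by (simp add: field_simps)
  qed
qed

lemma multiplier_norm_nonneg:
  assumes T: "T \<in> double_centralisers A"
  shows "0 \<le> cnorm (multiplier A) T"
proof (cases "\<exists>x\<in>carrier A. x \<noteq> \<zero>")
  case True
  then obtain x where x: "x \<in> carrier A" "x \<noteq> \<zero>" by blast
  have "0 \<le> cnorm (multiplier A) T * cnorm A x"
    using multiplier_norm_bound[OF T x(1)] norm_nonneg[OF double_centralisersD(1)[OF T x(1)]] by simp
  then show ?thesis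
    using x norm_nonneg[OF x(1)] norm_eq_0_iff[OF x(1)] by (simp add: zero_le_mult_iff)
next
  case False
  \<comment> \<open>In the zero algebra the supremum defining the norm is taken over \<open>{0}\<close>.\<close>
  then have "{x \<in> carrier A. cnorm A x \<le> 1} = {\<zero>}" using norm_zero by auto
  moreover have "fst T \<zero> = \<zero>" using False double_centralisersD(1)[OF T, of \<zero>] by blast
  ultimately show ?thesis by (simp add: multiplier_def split_beta norm_zero)
qed

lemma multiplier_norm_bound_snd:
  assumes T: "T \<in> double_centralisers A" and x: "x \<in> carrier A"
  shows "cnorm A (snd T x) \<le> cnorm (multiplier A) T * cnorm A x"
  using snd_norm_bound[of "fst T" "snd T" _ x] double_centralisersD[OF T]
    multiplier_norm_bound[OF T] multiplier_norm_nonneg[OF T] x by blast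

lemma multiplier_norm_star_le:
  assumes T: "T \<in> double_centralisers A"
  shows "cnorm (multiplier A) (star (multiplier A) T) \<le> cnorm (multiplier A) T"
  using multiplier_norm_bound_snd[OF T] multiplier_norm_nonneg[OF T] double_centralisersD(2)[OF T]
  by (intro multiplier_norm_least) (auto simp: norm_star star_closed, metis norm_star star_closed)

lemma multiplier_norm_mult_le:
  assumes S: "S \<in> double_centralisers A" and T: "T \<in> double_centralisers A"
  shows "cnorm (multiplier A) (S \<otimes>\<^bsub>multiplier A\<^esub> T) \<le> cnorm (multiplier A) S * cnorm (multiplier A) T"
proof (rule multiplier_norm_least)
  fix x assume x: "x \<in> carrier A"
  have "cnorm A (fst S (fst T x)) \<le> cnorm (multiplier A) S * cnorm A (fst T x)"
    by (rule multiplier_norm_bound) (use S x double_centralisersD[OF T] in auto)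
  also have "\<dots> \<le> cnorm (multiplier A) S * (cnorm (multiplier A) T * cnorm A x)"
    by (rule mult_left_mono) (use multiplier_norm_bound[OF T x] multiplier_norm_nonneg[OF S] in auto)
  finally show "cnorm A (fst (S \<otimes>\<^bsub>multiplier A\<^esub> T) x) \<le> cnorm (multiplier A) S * cnorm (multiplier A) T * cnorm A x"
    using x by (simp add: mult_ac)
qed (use multiplier_norm_nonneg S T in auto)

text \<open>
  The operator norm satisfies the C*-identity because \<open>\<parallel>T x\<parallel>\<^sup>2 = \<parallel>x\<^sup>* (T\<^sup>* T) x\<parallel> \<le> \<parallel>T\<^sup>* T\<parallel>\<close> for \<open>x\<close> in
  the unit ball.
\<close>

lemma multiplier_cstar_identity:
  assumes T: "T \<in> double_centralisers A"
  shows "cnorm (multiplier A) (star (multiplier A) T \<otimes>\<^bsub>multiplier A\<^esub> T) = (cnorm (multiplier A) T)\<^sup>2"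
    (is "?c = ?t\<^sup>2")
proof (rule antisym)
  note D = double_centralisersD[OF T]
  let ?sT = "star (multiplier A) T"
  have sT: "?sT \<in> double_centralisers A" using T by (rule multiplier_ops_closed)
  have C: "?sT \<otimes>\<^bsub>multiplier A\<^esub> T \<in> double_centralisers A" using sT T by (rule multiplier_ops_closed)
  have t: "0 \<le> ?t" and c: "0 \<le> ?c" using multiplier_norm_nonneg T C by auto
  show "?c \<le> ?t\<^sup>2"
    using multiplier_norm_mult_le[OF sT T] mult_right_mono[OF multiplier_norm_star_le[OF T] t]
    by (simp add: power2_eq_square)
  have "?t \<le> sqrt ?c"
  proof (rule multiplier_norm_least)
    fix x assume x: "x \<in> carrier A"
    have "(cnorm A (fst T x))\<^sup>2 = cnorm A (star A (fst T x) \<otimes> fst T x)"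
      using cstar_identity D(1)[OF x] by simp
    also have "star A (fst T x) \<otimes> fst T x = star A x \<otimes> fst (?sT \<otimes>\<^bsub>multiplier A\<^esub> T) x"
      using x D(1)[OF x] double_centralisersD(8)[OF sT, of "star A x" "fst T x"]
      by (simp add: star_closed star_star)
    also have "cnorm A \<dots> \<le> cnorm A x * (?c * cnorm A x)"
      using norm_mult[OF star_closed[OF x] double_centralisersD(1)[OF C x]]
        mult_left_mono[OF multiplier_norm_bound[OF C x] norm_nonneg[OF x]]
      by (simp add: norm_star[OF x])
    also have "\<dots> = (sqrt ?c * cnorm A x)\<^sup>2"
      using c by (simp add: power_mult_distrib, simp add: power2_eq_square)
    finally show "cnorm A (fst T x) \<le> sqrt ?c * cnorm A x"
      by (rule power2_le_imp_le) (use c norm_nonneg[OF x] in simp)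
  qed (use c in simp)
  then have "?t\<^sup>2 \<le> (sqrt ?c)\<^sup>2" using t by (rule power_mono)
  then show "?t\<^sup>2 \<le> ?c" using c by simp
qed

lemma cauchy_pointwise_convergent:
  assumes F: "\<And>n. F n \<in> carrier A"
    and X: "ccauchy B X"
    and bd: "\<And>m n. cnorm A (F m \<ominus> F n) \<le> cnorm B (X m \<ominus>\<^bsub>B\<^esub> X n) * c" and c: "0 \<le> c"
  shows "\<exists>l\<in>carrier A. cconv A F l"
proof (rule complete)
  show "ccauchy A F"
    unfolding ccauchy_def
  proof (intro allI impI)
    fix e :: real assume e: "0 < e"
    have "e / (c + 1) > 0" using e c by simp
    then obtain k where k: "\<And>m n. m \<ge> k \<Longrightarrow> n \<ge> k \<Longrightarrow> cnorm B (X m \<ominus>\<^bsub>B\<^esub> X n) < e / (c + 1)"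
      using X unfolding ccauchy_def by meson
    have "cnorm A (F m \<ominus> F n) < e" if "m \<ge> k" "n \<ge> k" for m n
    proof -
      have "cnorm A (F m \<ominus> F n) \<le> (e / (c + 1)) * c"
        using bd[of m n] mult_right_mono[OF less_imp_le[OF k[OF that]] c] by linarith
      also have "\<dots> < e" using e c by (simp add: field_simps)
      finally show ?thesis .
    qed
    then show "\<exists>k. \<forall>m\<ge>k. \<forall>n\<ge>k. cnorm A (F m \<ominus> F n) < e" by blast
  qed
qed (rule F)

text \<open>
  A Cauchy sequence \<open>(L\<^sub>n, R\<^sub>n)\<close> converges pointwise, and the identity \<open>R\<^sub>n(x) y = x L\<^sub>n(y)\<close> survives
  in the limit, which makes the limit a double centraliser. Letting one index of the
  Cauchy estimate tend to infinity turns pointwise convergence into convergence in norm.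
\<close>

lemma multiplier_complete:
  assumes X: "\<And>n. X n \<in> double_centralisers A" and cau: "ccauchy (multiplier A) X"
  shows "\<exists>T\<in>double_centralisers A. cconv (multiplier A) X T"
proof -
  note D = double_centralisersD[OF X]
  have bd: "cnorm A (fst (X m) x \<ominus> fst (X n) x) \<le> cnorm (multiplier A) (X m \<ominus>\<^bsub>multiplier A\<^esub> X n) * cnorm A x"
           "cnorm A (snd (X m) x \<ominus> snd (X n) x) \<le> cnorm (multiplier A) (X m \<ominus>\<^bsub>multiplier A\<^esub> X n) * cnorm A x"
    if "x \<in> carrier A" for x m n
    using multiplier_norm_bound[OF multiplier_diff(1)[OF X X] that, of m n]
      multiplier_norm_bound_snd[OF multiplier_diff(1)[OF X X] that, of m n]
    by (simp_all add: multiplier_diff[OF X X] that)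
  have "\<exists>l\<in>carrier A. cconv A (\<lambda>n. fst (X n) x) l" if "x \<in> carrier A" for x
    using cauchy_pointwise_convergent[OF _ cau, of "\<lambda>n. fst (X n) x" "cnorm A x"] that D bd norm_nonneg by simp
  then obtain L where L: "\<And>x. x \<in> carrier A \<Longrightarrow> L x \<in> carrier A \<and> cconv A (\<lambda>n. fst (X n) x) (L x)"
    by metis
  have "\<exists>l\<in>carrier A. cconv A (\<lambda>n. snd (X n) x) l" if "x \<in> carrier A" for x
    using cauchy_pointwise_convergent[OF _ cau, of "\<lambda>n. snd (X n) x" "cnorm A x"] that D bd norm_nonneg by simp
  then obtain R where R: "\<And>x. x \<in> carrier A \<Longrightarrow> R x \<in> carrier A \<and> cconv A (\<lambda>n. snd (X n) x) (R x)"
    by metis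
  have unif: "cnorm A (fst (X m) x \<ominus> L x) \<le> e * cnorm A x"
    if k: "\<And>m n. \<lbrakk>m \<ge> k; n \<ge> k\<rbrakk> \<Longrightarrow> cnorm (multiplier A) (X m \<ominus>\<^bsub>multiplier A\<^esub> X n) < e"
      and m: "m \<ge> k" and x: "x \<in> carrier A" for e k m x
  proof -
    have "(\<lambda>n. e * cnorm A x + cnorm A (fst (X n) x \<ominus> L x)) \<longlonglongrightarrow> e * cnorm A x + 0"
      using L[OF x] unfolding cconv_def by (intro tendsto_intros) auto
    moreover have "cnorm A (fst (X m) x \<ominus> L x) \<le> e * cnorm A x + cnorm A (fst (X n) x \<ominus> L x)"
      if "n \<ge> k" for n
    proof -
      have "cnorm A (fst (X m) x \<ominus> fst (X n) x) \<le> e * cnorm A x"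
        using bd(1)[OF x, of m n] mult_right_mono[OF less_imp_le[OF k[OF m that]] norm_nonneg[OF x]] by linarith
      then show ?thesis
        using norm_diff_triangle[of "fst (X m) x" "fst (X n) x" "L x"] D(1) x L by fastforce
    qed
    ultimately show ?thesis by (intro LIMSEQ_le_const[where a = "cnorm A (fst (X m) x \<ominus> L x)"]) auto
  qed
  define T where "T = (restrict L (carrier A), restrict R (carrier A))"
  have T: "T \<in> double_centralisers A"
  proof -
    obtain k where k: "\<And>m n. \<lbrakk>m \<ge> k; n \<ge> k\<rbrakk> \<Longrightarrow> cnorm (multiplier A) (X m \<ominus>\<^bsub>multiplier A\<^esub> X n) < 1"
      using cau unfolding ccauchy_def by (meson zero_less_one)
    show ?thesis
    proof (rule double_centralisersI[where K = "cnorm (multiplier A) (X k) + 1"])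
      fix x assume x: "x \<in> carrier A"
      have "cnorm A (L x) \<le> cnorm A (fst (X k) x) + cnorm A (L x \<ominus> fst (X k) x)"
        using norm_le_norm_diff x L D by blast
      also have "\<dots> \<le> cnorm (multiplier A) (X k) * cnorm A x + 1 * cnorm A x"
        using unif[OF k order_refl x] multiplier_norm_bound[OF X x, of k] norm_minus_commute x L D
        by (metis add_mono)
      finally show "cnorm A (fst T x) \<le> (cnorm (multiplier A) (X k) + 1) * cnorm A x"
        using x by (simp add: T_def ring_distribs)
    next
      fix x y assume x: "x \<in> carrier A" and y: "y \<in> carrier A"
      have eq: "snd (X n) x \<otimes> y = x \<otimes> fst (X n) y" for n using D(8) x y by blast
      have "cconv A (\<lambda>n. snd (X n) x \<otimes> y) (R x \<otimes> y)"
        by (rule cconv_mult_right) (use x y R D in auto)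
      moreover have "cconv A (\<lambda>n. snd (X n) x \<otimes> y) (x \<otimes> L y)"
        unfolding eq by (rule cconv_mult_left) (use x y L D in auto)
      ultimately have "R x \<otimes> y = x \<otimes> L y"
        using cconv_unique[of "\<lambda>n. snd (X n) x \<otimes> y"] x y L R D mult_closed by auto
      then show "snd T x \<otimes> y = x \<otimes> fst T y" using x y by (simp add: T_def)
    qed (use L R multiplier_norm_nonneg[OF X, of k] in \<open>auto simp: T_def\<close>)
  qed
  have "cconv (multiplier A) X T"
    unfolding cconv_def
  proof (rule LIMSEQ_I)
    fix r :: real assume r: "0 < r"
    then obtain k where k: "\<And>m n. \<lbrakk>m \<ge> k; n \<ge> k\<rbrakk> \<Longrightarrow> cnorm (multiplier A) (X m \<ominus>\<^bsub>multiplier A\<^esub> X n) < r / 2"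
      using cau unfolding ccauchy_def by (meson half_gt_zero)
    have "cnorm (multiplier A) (X n \<ominus>\<^bsub>multiplier A\<^esub> T) < r" if n: "n \<ge> k" for n
    proof -
      have "cnorm (multiplier A) (X n \<ominus>\<^bsub>multiplier A\<^esub> T) \<le> r / 2"
      proof (rule multiplier_norm_least)
        fix x assume x: "x \<in> carrier A"
        show "cnorm A (fst (X n \<ominus>\<^bsub>multiplier A\<^esub> T) x) \<le> r / 2 * cnorm A x"
          using unif[OF k n x] x multiplier_diff(2)[OF X T x, of n] by (simp add: T_def)
      qed (use r in simp)
      then show ?thesis using r by simp
    qed
    then show "\<exists>k. \<forall>n\<ge>k. norm (cnorm (multiplier A) (X n \<ominus>\<^bsub>multiplier A\<^esub> T) - 0) < r"
      using multiplier_norm_nonneg[OF multiplier_diff(1)[OF X T]] by (auto simp: abs_of_nonneg)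
  qed
  with T show ?thesis by blast
qed

theorem unital_cstar_algebra_multiplier: "unital_cstar_algebra (multiplier A)"
proof -
  interpret M: abelian_group "multiplier A" by (rule abelian_group_multiplier)
  note [simp] = multiplier_ops_closed double_centralisersD(1,2,5,6)
    star_closed star_star star_add star_smult norm_star smult_closed mult_closed
  show ?thesis
  proof unfold_locales
    fix T assume T: "T \<in> carrier (multiplier A)"
    then have T': "T \<in> double_centralisers A" by simp
    note D = double_centralisersD[OF T']
    show "0 \<le> cnorm (multiplier A) T" using multiplier_norm_nonneg T by simp
    show "cnorm (multiplier A) T = 0 \<longleftrightarrow> T = \<zero>\<^bsub>multiplier A\<^esub>"
    proof
      assume z: "cnorm (multiplier A) T = 0"
      show "T = \<zero>\<^bsub>multiplier A\<^esub>"
      proof (rule double_centralisers_eqI)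
        fix x assume x: "x \<in> carrier A"
        then show "fst T x = fst \<zero>\<^bsub>multiplier A\<^esub> x"
          using multiplier_norm_bound[OF T' x] norm_nonneg[OF D(1)[OF x]] z
          by (simp add: norm_eq_0_iff[OF D(1)[OF x]])
      qed (use T' in auto)
    next
      assume "T = \<zero>\<^bsub>multiplier A\<^esub>"
      then have "cnorm (multiplier A) T \<le> 0"
        by (intro multiplier_norm_least) (auto simp: norm_zero)
      then show "cnorm (multiplier A) T = 0" using multiplier_norm_nonneg[OF T'] by simp
    qed
    show "cnorm (multiplier A) (star (multiplier A) T \<otimes>\<^bsub>multiplier A\<^esub> T) = (cnorm (multiplier A) T)\<^sup>2"
      using multiplier_cstar_identity[OF T'] .
    show "cnorm (multiplier A) (c \<odot>\<^bsub>multiplier A\<^esub> T) = cmod c * cnorm (multiplier A) T" for c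
    proof -
      have le: "cnorm (multiplier A) (c \<odot>\<^bsub>multiplier A\<^esub> S) \<le> cmod c * cnorm (multiplier A) S"
        if S: "S \<in> double_centralisers A" for c S
        by (rule multiplier_norm_least)
          (use S multiplier_norm_bound[OF S] multiplier_norm_nonneg[OF S]
            in \<open>auto simp: norm_smult mult.assoc mult_left_mono\<close>)
      show ?thesis
      proof (cases "c = 0")
        case True
        then show ?thesis
          using le[OF T', of 0] multiplier_norm_nonneg[of "0 \<odot>\<^bsub>multiplier A\<^esub> T"] T' by simp
      next
        case False
        have "inverse c \<odot>\<^bsub>multiplier A\<^esub> (c \<odot>\<^bsub>multiplier A\<^esub> T) = T"
          by (rule double_centralisers_eqI)
            (use T' False in \<open>auto simp: smult_smult[symmetric] smult_one\<close>)
        then have "cnorm (multiplier A) T \<le> cmod (inverse c) * cnorm (multiplier A) (c \<odot>\<^bsub>multiplier A\<^esub> T)"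
          using le[of "c \<odot>\<^bsub>multiplier A\<^esub> T" "inverse c"] T' by simp
        then have "cmod c * cnorm (multiplier A) T \<le> cnorm (multiplier A) (c \<odot>\<^bsub>multiplier A\<^esub> T)"
          using False mult_left_mono[of "cnorm (multiplier A) T" _ "cmod c"]
          by (simp add: norm_divide field_simps)
        then show ?thesis using le[OF T', of c] by simp
      qed
    qed
  next
    fix S T assume S: "S \<in> carrier (multiplier A)" and T: "T \<in> carrier (multiplier A)"
    then have S': "S \<in> double_centralisers A" and T': "T \<in> double_centralisers A" by simp_all
    show "cnorm (multiplier A) (S \<otimes>\<^bsub>multiplier A\<^esub> T) \<le> cnorm (multiplier A) S * cnorm (multiplier A) T"
      by (rule multiplier_norm_mult_le[OF S' T'])
    show "cnorm (multiplier A) (S \<oplus>\<^bsub>multiplier A\<^esub> T) \<le> cnorm (multiplier A) S + cnorm (multiplier A) T"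
    proof (rule multiplier_norm_least)
      fix x assume x: "x \<in> carrier A"
      show "cnorm A (fst (S \<oplus>\<^bsub>multiplier A\<^esub> T) x)
              \<le> (cnorm (multiplier A) S + cnorm (multiplier A) T) * cnorm A x"
        using multiplier_norm_bound[OF S' x] multiplier_norm_bound[OF T' x]
          norm_triangle[of "fst S x" "fst T x"] S' T' x by (simp add: ring_distribs)
    qed (use multiplier_norm_nonneg S' T' in auto)
  next
    fix X :: "nat \<Rightarrow> 'a dcent"
    assume "\<And>n. X n \<in> carrier (multiplier A)" "ccauchy (multiplier A) X"
    then show "\<exists>T\<in>carrier (multiplier A). cconv (multiplier A) X T"
      using multiplier_complete by simp
  qed ((rule double_centralisers_eqI;
        simp add: smult_add_left smult_add_right smult_smult smult_one star_smult) | simp)+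
qed

text \<open>
  Because of these rules, compression by a projection of the multiplier algebra maps the copy
  of \<open>A\<close> to itself.
\<close>

lemma mult_embed_ideal:
  assumes T: "T \<in> double_centralisers A" and x: "x \<in> carrier A"
  shows "T \<otimes>\<^bsub>multiplier A\<^esub> mult_embed A x = mult_embed A (fst T x)"
    and "mult_embed A x \<otimes>\<^bsub>multiplier A\<^esub> T = mult_embed A (snd T x)"
    and "star (multiplier A) (mult_embed A x) = mult_embed A (star A x)"
proof -
  note [simp] = T x multiplier_ops_closed double_centralisersD(1,2,7,8)[OF T] mult_closed mult_assoc
    star_closed star_mult star_star
  show "T \<otimes>\<^bsub>multiplier A\<^esub> mult_embed A x = mult_embed A (fst T x)"
    by (rule double_centralisers_eqI) simp_all
  show "mult_embed A x \<otimes>\<^bsub>multiplier A\<^esub> T = mult_embed A (snd T x)"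
    by (rule double_centralisers_eqI) simp_all
  show "star (multiplier A) (mult_embed A x) = mult_embed A (star A x)"
    by (rule double_centralisers_eqI) simp_all
qed

end

section \<open>Subalgebras and corners\<close>

lemma closed_subspaceD:
  assumes "closed_subspace A C"
  shows "C \<subseteq> carrier A" "\<zero>\<^bsub>A\<^esub> \<in> C"
    and "\<And>x y. \<lbrakk>x \<in> C; y \<in> C\<rbrakk> \<Longrightarrow> x \<oplus>\<^bsub>A\<^esub> y \<in> C"
    and "\<And>c x. x \<in> C \<Longrightarrow> c \<odot>\<^bsub>A\<^esub> x \<in> C"
    and "\<And>X x. \<lbrakk>\<And>n. X n \<in> C; x \<in> carrier A; cconv A X x\<rbrakk> \<Longrightarrow> x \<in> C"
  using assms unfolding closed_subspace_def by blast+

lemma cstar_subalgebraD: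
  assumes "cstar_subalgebra A C"
  shows "closed_subspace A C"
    and "\<And>x y. \<lbrakk>x \<in> C; y \<in> C\<rbrakk> \<Longrightarrow> x \<otimes>\<^bsub>A\<^esub> y \<in> C"
    and "\<And>x. x \<in> C \<Longrightarrow> star A x \<in> C"
  using assms unfolding cstar_subalgebra_def by blast+

lemma closed_subspace_Inter:
  assumes "\<F> \<noteq> {}" and sub: "\<And>C. C \<in> \<F> \<Longrightarrow> closed_subspace A C"
  shows "closed_subspace A (\<Inter>\<F>)"
  unfolding closed_subspace_def
proof (intro conjI ballI allI impI)
  note D = closed_subspaceD[OF sub]
  show "\<Inter>\<F> \<subseteq> carrier A" using assms(1) D(1) by blast
  show "\<zero>\<^bsub>A\<^esub> \<in> \<Inter>\<F>" using D(2) by blast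
  show "x \<oplus>\<^bsub>A\<^esub> y \<in> \<Inter>\<F>" if "x \<in> \<Inter>\<F>" "y \<in> \<Inter>\<F>" for x y
    using that D(3) by blast
  show "c \<odot>\<^bsub>A\<^esub> x \<in> \<Inter>\<F>" if "x \<in> \<Inter>\<F>" for c x using that D(4) by blast
  show "x \<in> \<Inter>\<F>" if "(\<forall>n. X n \<in> \<Inter>\<F>) \<and> x \<in> carrier A \<and> cconv A X x" for X x
    using that D(5)[of _ X x] by blast
qed

lemma closed_subspace_closed_span:
  assumes "closed_subspace A C" and "S \<subseteq> C"
  shows "closed_subspace A (closed_span A S)"
  unfolding closed_span_def by (rule closed_subspace_Inter) (use assms in blast)+

lemma cstar_subalgebra_cstar_generated:
  assumes "cstar_subalgebra A C" and "S \<subseteq> C"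
  shows "cstar_subalgebra A (cstar_generated A S)"
proof -
  have "closed_subspace A (cstar_generated A S)"
    unfolding cstar_generated_def
    by (rule closed_subspace_Inter) (use assms cstar_subalgebraD(1) in blast)+
  moreover have "x \<otimes>\<^bsub>A\<^esub> y \<in> cstar_generated A S" if "x \<in> cstar_generated A S" "y \<in> cstar_generated A S" for x y
    using that unfolding cstar_generated_def cstar_subalgebra_def by blast
  moreover have "star A x \<in> cstar_generated A S" if "x \<in> cstar_generated A S" for x
    using that unfolding cstar_generated_def cstar_subalgebra_def by blast
  ultimately show ?thesis unfolding cstar_subalgebra_def by blast
qed

lemma cstar_generatedI: "x \<in> S \<Longrightarrow> x \<in> cstar_generated A S"
  unfolding cstar_generated_def by blast

lemma cstar_generated_least: "\<lbrakk>cstar_subalgebra A C; S \<subseteq> C\<rbrakk> \<Longrightarrow> cstar_generated A S \<subseteq> C"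
  unfolding cstar_generated_def by blast

lemma closed_spanI: "x \<in> S \<Longrightarrow> x \<in> closed_span A S"
  unfolding closed_span_def by blast

lemma closed_span_least: "\<lbrakk>closed_subspace A C; S \<subseteq> C\<rbrakk> \<Longrightarrow> closed_span A S \<subseteq> C"
  unfolding closed_span_def by blast

context cstar_algebra
begin

lemma closed_subspace_carrier: "closed_subspace A (carrier A)"
  by (simp add: closed_subspace_def smult_closed)

lemma cstar_subalgebra_carrier: "cstar_subalgebra A (carrier A)"
  by (simp add: cstar_subalgebra_def closed_subspace_carrier mult_closed star_closed)

text \<open>
  Additive inverses, and with them subtraction and convergence, are defined relative to the
  carrier, so they have to be compared when the carrier shrinks.
\<close>

lemma closed_subspace_group:
  assumes C: "closed_subspace A C"
  shows "abelian_group (A\<lparr>carrier := C, one := e\<rparr>)"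
    and "\<lbrakk>x \<in> C; y \<in> C\<rbrakk> \<Longrightarrow> x \<ominus>\<^bsub>A\<lparr>carrier := C, one := e\<rparr>\<^esub> y = x \<ominus> y"
proof -
  note D = closed_subspaceD[OF C]
  have inA: "x \<in> C \<Longrightarrow> x \<in> carrier A" for x using D(1) by blast
  have neg: "(-1) \<odot> x \<oplus> x = \<zero>" if "x \<in> C" for x
    using inA[OF that] by (simp add: a_inv_eq_smult[symmetric] l_neg)
  show ag: "abelian_group (A\<lparr>carrier := C, one := e\<rparr>)"
  proof (rule abelian_groupI)
    show "\<exists>y\<in>carrier (A\<lparr>carrier := C, one := e\<rparr>).
        y \<oplus>\<^bsub>A\<lparr>carrier := C, one := e\<rparr>\<^esub> x = \<zero>\<^bsub>A\<lparr>carrier := C, one := e\<rparr>\<^esub>"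
      if "x \<in> carrier (A\<lparr>carrier := C, one := e\<rparr>)" for x
      using that D(4)[of x "-1"] neg[of x] by auto
  qed (use D(2,3) inA in \<open>auto simp: a_ac\<close>)
  interpret S: abelian_group "A\<lparr>carrier := C, one := e\<rparr>" by (rule ag)
  assume x: "x \<in> C" and y: "y \<in> C"
  have "\<ominus>\<^bsub>A\<lparr>carrier := C, one := e\<rparr>\<^esub> y = (-1) \<odot> y"
    by (rule S.minus_equality) (use neg[OF y] D(4)[OF y] y in auto)
  then show "x \<ominus>\<^bsub>A\<lparr>carrier := C, one := e\<rparr>\<^esub> y = x \<ominus> y"
    using inA[OF y] by (simp add: a_minus_def a_inv_eq_smult)
qed

lemma unital_cstar_algebra_subalgebra:
  assumes C: "cstar_subalgebra A C" and e: "e \<in> C" "\<And>x. x \<in> C \<Longrightarrow> e \<otimes> x = x \<and> x \<otimes> e = x"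
  shows "unital_cstar_algebra (A\<lparr>carrier := C, one := e\<rparr>)"
proof -
  let ?B = "A\<lparr>carrier := C, one := e\<rparr>"
  note D = closed_subspaceD[OF cstar_subalgebraD(1)[OF C]]
  have inA: "x \<in> C \<Longrightarrow> x \<in> carrier A" for x using D(1) by blast
  note minus = closed_subspace_group(2)[OF cstar_subalgebraD(1)[OF C], of _ _ e]
  interpret S: abelian_group ?B by (rule closed_subspace_group(1)[OF cstar_subalgebraD(1)[OF C]])
  note [simp] = inA D(3,4) cstar_subalgebraD[OF C] mult_assoc distrib_left distrib_right
    smult_add_left smult_add_right smult_smult smult_one smult_mult_left smult_mult_right
    star_star star_add star_smult star_mult norm_nonneg norm_eq_0_iff norm_triangle norm_smult
    norm_mult cstar_identity e
  have comp: "\<exists>x\<in>C. cconv ?B X x" if X: "\<And>n. X n \<in> C" and cau: "ccauchy ?B X" for X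
  proof -
    have "ccauchy A X" using cau X by (simp add: ccauchy_def minus)
    then obtain x where x: "x \<in> carrier A" "cconv A X x" using complete X inA by blast
    then have "x \<in> C" using D(5) X by blast
    then show ?thesis using x X by (auto simp: cconv_def minus)
  qed
  show ?thesis
    by unfold_locales (use comp in \<open>simp_all\<close>)
qed

end

context unital_cstar_algebra
begin

text \<open>
  Compression by \<open>p\<close> is idempotent on the ideal \<open>I\<close>, so its image consists of the \<open>x \<in> I\<close> with
  \<open>p x = x = x p\<close>; these equations are preserved by limits.
\<close>

lemma cstar_subalgebra_corner:
  assumes I: "closed_subspace A I"
    and ideal: "\<And>t x. \<lbrakk>t \<in> carrier A; x \<in> I\<rbrakk> \<Longrightarrow> t \<otimes> x \<in> I \<and> x \<otimes> t \<in> I"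
    and star: "\<And>x. x \<in> I \<Longrightarrow> star A x \<in> I"
    and p: "p \<in> carrier A" "p \<otimes> p = p" "star A p = p"
  shows "cstar_subalgebra A ((\<lambda>x. p \<otimes> x \<otimes> p) ` I)"
    and "\<And>x. x \<in> (\<lambda>x. p \<otimes> x \<otimes> p) ` I \<longleftrightarrow> x \<in> I \<and> p \<otimes> x = x \<and> x \<otimes> p = x"
proof -
  let ?C = "(\<lambda>x. p \<otimes> x \<otimes> p) ` I"
  note D = closed_subspaceD[OF I]
  have inA: "x \<in> I \<Longrightarrow> x \<in> carrier A" for x using D(1) by blast
  have pp: "p \<otimes> (p \<otimes> x) = p \<otimes> x" if "x \<in> carrier A" for x
    using that p mult_assoc[of p p x] by simp
  show mem: "x \<in> ?C \<longleftrightarrow> x \<in> I \<and> p \<otimes> x = x \<and> x \<otimes> p = x" for x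
  proof
    assume "x \<in> ?C"
    then show "x \<in> I \<and> p \<otimes> x = x \<and> x \<otimes> p = x"
      using p ideal inA by (auto simp: mult_assoc mult_closed pp)
  next
    assume x: "x \<in> I \<and> p \<otimes> x = x \<and> x \<otimes> p = x"
    show "x \<in> ?C" by (rule image_eqI[of x _ x]) (use x in simp_all)
  qed
  have eqs: "p \<otimes> x = x" "x \<otimes> p = x" "x \<in> I" "x \<in> carrier A" if "x \<in> ?C" for x
    using mem[of x] inA[of x] that by simp_all
  show "cstar_subalgebra A ?C"
    unfolding cstar_subalgebra_def closed_subspace_def
  proof (intro conjI ballI allI impI)
    show "?C \<subseteq> carrier A" using eqs by blast
    show "\<zero> \<in> ?C" using mem D(2) p by (simp add: mult_zero_left mult_zero_right)
    fix x assume x: "x \<in> ?C"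
    show "c \<odot> x \<in> ?C" for c
      unfolding mem using eqs[OF x] p D(4) by (simp add: smult_mult_left smult_mult_right)
    show "star A x \<in> ?C"
      unfolding mem using eqs[OF x] p star by (metis star_mult)
    fix y assume y: "y \<in> ?C"
    show "x \<oplus> y \<in> ?C"
      unfolding mem using eqs[OF x] eqs[OF y] p D(3) by (simp add: distrib_left distrib_right)
    show "x \<otimes> y \<in> ?C"
      unfolding mem using eqs[OF x] eqs[OF y] p ideal by (metis mult_assoc)
  next
    fix X x assume X: "(\<forall>n. X n \<in> ?C) \<and> x \<in> carrier A \<and> cconv A X x"
    then have XC: "X n \<in> ?C" for n by blast
    have x: "x \<in> carrier A" "cconv A X x" using X by blast+
    have "cconv A X (p \<otimes> x)" "cconv A X (x \<otimes> p)"
      using cconv_mult_left[of X x p] cconv_mult_right[of X x p] eqs[OF XC] x p by simp_all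
    then have "p \<otimes> x = x" "x \<otimes> p = x"
      using cconv_unique[of X] eqs(4)[OF XC] x p mult_closed by blast+
    moreover have "x \<in> I" using D(5)[of X x] eqs(3)[OF XC] x by blast
    ultimately show "x \<in> ?C" using mem by blast
  qed
qed

end

section \<open>Automatic continuity on algebras of bounded functions\<close>

lemma linfty_sel [simp]:
  "f \<otimes>\<^bsub>linfty N\<^esub> h = (\<lambda>y. f y * h y)"
  "f \<oplus>\<^bsub>linfty N\<^esub> h = (\<lambda>y. f y + h y)"
  "c \<odot>\<^bsub>linfty N\<^esub> f = (\<lambda>y. c * f y)"
  "\<zero>\<^bsub>linfty N\<^esub> = (\<lambda>y. 0)"
  "star (linfty N) f = (\<lambda>y. cnj (f y))"
  by (simp_all add: linfty_def)

lemma linfty_carrier_iff: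
  "f \<in> carrier (linfty N) \<longleftrightarrow> (\<forall>y. y \<notin> N \<longrightarrow> f y = 0) \<and> (\<exists>K. \<forall>y\<in>N. cmod (f y) \<le> K)"
  by (simp add: linfty_def)

lemma linfty_carrierI:
  "\<lbrakk>\<And>y. y \<notin> N \<Longrightarrow> f y = 0; \<And>y. y \<in> N \<Longrightarrow> cmod (f y) \<le> K\<rbrakk> \<Longrightarrow> f \<in> carrier (linfty N)"
  by (auto simp: linfty_carrier_iff)

lemma linfty_norm_upper: "\<lbrakk>f \<in> carrier (linfty N); y \<in> N\<rbrakk> \<Longrightarrow> cmod (f y) \<le> cnorm (linfty N) f"
  by (auto simp: linfty_def intro!: cSUP_upper bdd_aboveI2)

lemma linfty_norm_least: "\<lbrakk>N \<noteq> {}; \<And>y. y \<in> N \<Longrightarrow> cmod (f y) \<le> c\<rbrakk> \<Longrightarrow> cnorm (linfty N) f \<le> c"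
  by (simp add: linfty_def cSUP_least)

lemma linfty_closed:
  assumes f: "f \<in> carrier (linfty N)"
  shows "h \<in> carrier (linfty N) \<Longrightarrow> (\<lambda>y. f y + h y) \<in> carrier (linfty N)"
    and "h \<in> carrier (linfty N) \<Longrightarrow> (\<lambda>y. f y * h y) \<in> carrier (linfty N)"
    and "(\<lambda>y. c * f y) \<in> carrier (linfty N)"
    and "(\<lambda>y. cnj (f y)) \<in> carrier (linfty N)"
proof -
  have f0: "f y = 0" if "y \<notin> N" for y using f that by (simp add: linfty_carrier_iff)
  note fb = linfty_norm_upper[OF f]
  show "(\<lambda>y. c * f y) \<in> carrier (linfty N)"
    by (rule linfty_carrierI[where K = "cmod c * cnorm (linfty N) f"])
      (use f0 fb in \<open>auto simp: norm_mult mult_left_mono\<close>)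
  show "(\<lambda>y. cnj (f y)) \<in> carrier (linfty N)"
    by (rule linfty_carrierI[where K = "cnorm (linfty N) f"]) (use f0 fb in auto)
  assume h: "h \<in> carrier (linfty N)"
  have h0: "h y = 0" if "y \<notin> N" for y using h that by (simp add: linfty_carrier_iff)
  note hb = linfty_norm_upper[OF h]
  show "(\<lambda>y. f y + h y) \<in> carrier (linfty N)"
    by (rule linfty_carrierI[where K = "cnorm (linfty N) f + cnorm (linfty N) h"])
      (use f0 h0 norm_triangle_mono[OF fb hb] in auto)
  show "(\<lambda>y. f y * h y) \<in> carrier (linfty N)"
    by (rule linfty_carrierI[where K = "cnorm (linfty N) f * cnorm (linfty N) h"])
      (use f0 h0 in \<open>auto simp: norm_mult intro!: mult_mono fb hb order_trans[OF norm_ge_zero fb]\<close>)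
qed

lemma linfty_diff:
  assumes "f \<in> carrier (linfty N)" "h \<in> carrier (linfty N)"
  shows "f \<ominus>\<^bsub>linfty N\<^esub> h = (\<lambda>y. f y - h y)"
proof -
  have ag: "abelian_group (linfty N)"
  proof (rule abelian_groupI)
    show "\<exists>g\<in>carrier (linfty N). g \<oplus>\<^bsub>linfty N\<^esub> f = \<zero>\<^bsub>linfty N\<^esub>" if "f \<in> carrier (linfty N)" for f
      using linfty_closed(3)[OF that, of "-1"] by (intro bexI[of _ "\<lambda>y. - f y"]) auto
    show "\<zero>\<^bsub>linfty N\<^esub> \<in> carrier (linfty N)" by (simp add: linfty_carrier_iff) (use order_refl in blast)
  qed (auto simp: linfty_closed algebra_simps)
  interpret L: abelian_group "linfty N" by (rule ag)
  have "\<ominus>\<^bsub>linfty N\<^esub> h = (\<lambda>y. - h y)"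
    by (rule L.minus_equality) (use assms linfty_closed(3)[OF assms(2), of "-1"] in auto)
  then show ?thesis by (simp add: a_minus_def)
qed

lemma linfty_cconvI:
  assumes "N \<noteq> {}" "\<And>n. F n \<in> carrier (linfty N)" "f \<in> carrier (linfty N)" "b \<longlonglongrightarrow> 0"
    and "\<And>n y. y \<in> N \<Longrightarrow> cmod (F n y - f y) \<le> b n"
  shows "cconv (linfty N) F f"
  unfolding cconv_def
proof (rule tendsto_sandwich[OF _ _ tendsto_const assms(4)])
  obtain y where y: "y \<in> N" using assms(1) by blast
  have *: "(\<lambda>y. F n y - f y) \<in> carrier (linfty N)" for n
    using linfty_closed(1)[OF assms(2) linfty_closed(3)[OF assms(3), of "-1"], of n] by simp
  show "\<forall>\<^sub>F n in sequentially. 0 \<le> cnorm (linfty N) (F n \<ominus>\<^bsub>linfty N\<^esub> f)"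
    using order_trans[OF norm_ge_zero linfty_norm_upper[OF * y]] assms(2,3) by (simp add: linfty_diff)
  show "\<forall>\<^sub>F n in sequentially. cnorm (linfty N) (F n \<ominus>\<^bsub>linfty N\<^esub> f) \<le> b n"
    using assms by (simp add: linfty_diff linfty_norm_least)
qed

lemma cstar_subalgebra_linfty: "cstar_subalgebra (linfty N) (carrier (linfty N))"
  unfolding cstar_subalgebra_def closed_subspace_def
  by (auto simp: linfty_closed intro: linfty_carrierI[where K = 0])

lemma charfun_Un_disjoint: "S \<inter> T = {} \<Longrightarrow> charfun (S \<union> T) = (\<lambda>y. charfun S y + charfun T y)"
  by (auto simp: charfun_def fun_eq_iff)

lemma charfun_Int: "charfun (S \<inter> T) = (\<lambda>y. charfun S y * charfun T y)"
  by (auto simp: charfun_def fun_eq_iff)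

lemma charfun_empty: "charfun {} = (\<lambda>y. 0)"
  by (auto simp: charfun_def fun_eq_iff)

lemma charfun_Union_mem:
  assumes "closed_subspace (linfty N) C" "finite \<F>" "pairwise disjnt \<F>" "\<And>S. S \<in> \<F> \<Longrightarrow> charfun S \<in> C"
  shows "charfun (\<Union>\<F>) \<in> C"
  using assms(2-)
proof (induction \<F> rule: finite_induct)
  case empty
  then show ?case using closed_subspaceD(2)[OF assms(1)] by (simp add: charfun_empty)
next
  case (insert S \<F>)
  then have "charfun S \<in> C" "charfun (\<Union>\<F>) \<in> C" by (auto simp: pairwise_insert)
  moreover have "S \<inter> \<Union>\<F> = {}" using insert by (auto simp: pairwise_insert disjnt_def)
  ultimately show ?case
    using closed_subspaceD(3)[OF assms(1), of "charfun S" "charfun (\<Union>\<F>)"] by (simp add: charfun_Un_disjoint)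
qed

text \<open>
  The solution \<open>s = 1 - sqrt (1 - t\<^sup>2)\<close> of \<open>s = (t\<^sup>2 + s\<^sup>2) / 2\<close> is approached by iterating the right
  side, a contraction on \<open>[0, 1/2]\<close> with constant \<open>1/2\<close>.
\<close>

primrec sqrt_iter :: "real \<Rightarrow> nat \<Rightarrow> real" where
  "sqrt_iter t 0 = 0"
| "sqrt_iter t (Suc n) = (t\<^sup>2 + (sqrt_iter t n)\<^sup>2) / 2"

lemma sqrt_iter_converges:
  assumes t: "\<bar>t\<bar> \<le> 1/2"
  shows "\<bar>sqrt_iter t n - (1 - sqrt (1 - t\<^sup>2))\<bar> \<le> (1/2) ^ n"
proof -
  define s where "s = 1 - sqrt (1 - t\<^sup>2)"
  have t2: "t\<^sup>2 \<le> 1/4" using power_mono[OF t abs_ge_zero, of 2] by (simp add: power2_eq_square)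
  have "sqrt (1/4) \<le> sqrt (1 - t\<^sup>2)" using t2 by (intro real_sqrt_le_mono) simp
  then have s: "0 \<le> s" "s \<le> 1/2" by (simp_all add: s_def real_sqrt_divide)
  have eq: "s = (t\<^sup>2 + s\<^sup>2) / 2" using t2 by (simp add: s_def power2_diff)
  have "0 \<le> sqrt_iter t n \<and> sqrt_iter t n \<le> 1/2 \<and> \<bar>sqrt_iter t n - s\<bar> \<le> (1/2) ^ n" for n
  proof (induction n)
    case 0
    then show ?case using s by simp
  next
    case (Suc n)
    define q where "q = sqrt_iter t n"
    have q: "0 \<le> q" "q \<le> 1/2" "\<bar>q - s\<bar> \<le> (1/2) ^ n" using Suc q_def by auto
    have "q\<^sup>2 \<le> 1/4" using power_mono[OF q(2,1), of 2] by (simp add: power2_eq_square)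
    moreover have "(t\<^sup>2 + q\<^sup>2) / 2 - s = (q - s) * ((q + s) / 2)"
    proof -
      have "(q - s) * ((q + s) / 2) = (t\<^sup>2 + q\<^sup>2) / 2 - (t\<^sup>2 + s\<^sup>2) / 2"
        by (simp add: field_simps power2_eq_square)
      then show ?thesis using eq by simp
    qed
    then have "\<bar>(t\<^sup>2 + q\<^sup>2) / 2 - s\<bar> = \<bar>q - s\<bar> * \<bar>(q + s) / 2\<bar>"
      by (simp only: abs_mult)
    then have "\<bar>(t\<^sup>2 + q\<^sup>2) / 2 - s\<bar> = \<bar>q - s\<bar> * ((q + s) / 2)"
      using q s by simp
    moreover have "\<dots> \<le> (1/2) ^ n * (1/2)" using q s by (intro mult_mono) auto
    ultimately show ?case using t2 by (simp add: q_def[symmetric])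
  qed
  then show ?thesis by (simp add: s_def)
qed

text \<open>
  The iterates are polynomials in \<open>r\<close> without constant term, hence available in an algebra that
  need not contain the constants.
\<close>

lemma subalgebra_contains_sqrt:
  assumes N: "N \<noteq> {}" and C: "cstar_subalgebra (linfty N) C"
    and d: "(\<lambda>y. complex_of_real (r y)) \<in> C" and r: "\<And>y. \<bar>r y\<bar> \<le> 1/2"
  shows "(\<lambda>y. complex_of_real (1 - sqrt (1 - (r y)\<^sup>2))) \<in> C"
proof -
  note CD = closed_subspaceD[OF cstar_subalgebraD(1)[OF C]]
  let ?F = "\<lambda>n y. complex_of_real (sqrt_iter (r y) n)"
  let ?f = "\<lambda>y. complex_of_real (1 - sqrt (1 - (r y)\<^sup>2))"
  have F: "?F n \<in> C" for n
  proof (induction n)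
    case 0
    then show ?case using CD(2) by simp
  next
    case (Suc n)
    have "(1/2) \<odot>\<^bsub>linfty N\<^esub> (((\<lambda>y. complex_of_real (r y)) \<otimes>\<^bsub>linfty N\<^esub> (\<lambda>y. complex_of_real (r y)))
        \<oplus>\<^bsub>linfty N\<^esub> (?F n \<otimes>\<^bsub>linfty N\<^esub> ?F n)) \<in> C"
      by (intro CD(3,4) cstar_subalgebraD(2)[OF C] d Suc)
    then show ?case by (simp add: power2_eq_square add_divide_distrib)
  qed
  have r0: "r y = 0" if "y \<notin> N" for y
    using CD(1) d that by (auto simp: linfty_carrier_iff)
  have f: "?f \<in> carrier (linfty N)"
  proof (rule linfty_carrierI[where K = 1])
    fix y assume "y \<in> N"
    have "(r y)\<^sup>2 \<le> 1" using power_mono[OF r abs_ge_zero, of y 2] by (simp add: power2_eq_square)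
    then have "0 \<le> sqrt (1 - (r y)\<^sup>2)" "sqrt (1 - (r y)\<^sup>2) \<le> 1" by simp_all
    then show "cmod (?f y) \<le> 1" by (subst norm_of_real) linarith
  qed (simp add: r0)
  have "cconv (linfty N) ?F ?f"
  proof (rule linfty_cconvI[OF N, where b = "\<lambda>n. (1/2) ^ n"])
    show "(\<lambda>n. (1/2 :: real) ^ n) \<longlonglongrightarrow> 0" by (rule LIMSEQ_power_zero) simp
    fix n y
    show "cmod (?F n y - ?f y) \<le> (1/2) ^ n"
      unfolding of_real_diff[symmetric] norm_of_real by (rule sqrt_iter_converges[OF r])
  qed (use F CD(1) f in auto)
  then show ?thesis using CD(5)[of ?F ?f] F f by blast
qed

context unital_cstar_algebra
begin

lemma star_one: "star A \<one> = \<one>"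
  by (metis mult_one one_closed one_mult star_closed star_mult star_star)

lemma norm_one_le: "cnorm A \<one> \<le> 1"
proof (rule ccontr)
  assume "\<not> ?thesis"
  moreover have "cnorm A \<one> * cnorm A \<one> = cnorm A \<one>"
    using cstar_identity[OF one_closed] by (simp add: star_one one_mult one_closed power2_eq_square)
  ultimately show False by simp
qed

text \<open>The element \<open>t + i w\<close> is an isometry, hence of norm at most \<open>1\<close>, and \<open>t\<close> is its real part.\<close>

lemma norm_le_one_of_squares:
  assumes t: "t \<in> carrier A" "star A t = t" and w: "w \<in> carrier A" "star A w = w"
    and comm: "t \<otimes> w = w \<otimes> t" and sum: "t \<otimes> t \<oplus> w \<otimes> w = \<one>"
  shows "cnorm A t \<le> 1"
proof -
  define v where "v = t \<oplus> \<i> \<odot> w"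
  have v: "v \<in> carrier A" and sv: "star A v = t \<oplus> (-\<i>) \<odot> w"
    using t w by (simp_all add: v_def smult_closed star_add star_smult)
  have i: "\<i> \<odot> (w \<otimes> t) \<oplus> (-\<i>) \<odot> (w \<otimes> t) = \<zero>"
    using smult_add_left[of "w \<otimes> t" \<i> "-\<i>"] t w by (simp add: mult_closed smult_zero_left)
  have "star A v \<otimes> v = t \<otimes> t \<oplus> w \<otimes> w \<oplus> (\<i> \<odot> (w \<otimes> t) \<oplus> (-\<i>) \<odot> (w \<otimes> t))"
    using t w unfolding sv
    by (simp add: v_def distrib_left distrib_right smult_closed mult_closed smult_mult_left
        smult_mult_right smult_add_right smult_smult[symmetric] smult_one comm a_ac)
  then have "star A v \<otimes> v = \<one>"
    using sum one_closed by (simp add: i)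
  then have "(cnorm A v)\<^sup>2 \<le> 1\<^sup>2" using cstar_identity[OF v] norm_one_le by simp
  then have v1: "cnorm A v \<le> 1" by (rule power2_le_imp_le) simp
  have "v \<oplus> star A v = (1 \<odot> t \<oplus> 1 \<odot> t) \<oplus> (\<i> \<odot> w \<oplus> (-\<i>) \<odot> w)"
    using t w unfolding sv by (simp add: v_def smult_closed smult_one a_ac)
  also have "\<dots> = 2 \<odot> t"
    using t w smult_add_left[of t 1 1] smult_add_left[of w \<i> "-\<i>"] by (simp add: smult_zero_left smult_closed)
  finally have "2 * cnorm A t = cnorm A (v \<oplus> star A v)" using t by (simp add: norm_smult)
  also have "\<dots> \<le> 2" using norm_triangle[of v "star A v"] v v1 by (simp add: star_closed norm_star)
  finally show ?thesis by simp
qed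

end

lemma cstar_homD:
  assumes "\<phi> \<in> cstar_hom A B"
  shows "\<And>x. x \<in> carrier A \<Longrightarrow> \<phi> x \<in> carrier B"
    and "\<And>x y. \<lbrakk>x \<in> carrier A; y \<in> carrier A\<rbrakk> \<Longrightarrow> \<phi> (x \<oplus>\<^bsub>A\<^esub> y) = \<phi> x \<oplus>\<^bsub>B\<^esub> \<phi> y"
    and "\<And>c x. x \<in> carrier A \<Longrightarrow> \<phi> (c \<odot>\<^bsub>A\<^esub> x) = c \<odot>\<^bsub>B\<^esub> \<phi> x"
    and "\<And>x y. \<lbrakk>x \<in> carrier A; y \<in> carrier A\<rbrakk> \<Longrightarrow> \<phi> (x \<otimes>\<^bsub>A\<^esub> y) = \<phi> x \<otimes>\<^bsub>B\<^esub> \<phi> y"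
    and "\<And>x. x \<in> carrier A \<Longrightarrow> \<phi> (star A x) = star B (\<phi> x)"
  using assms unfolding cstar_hom_def by (auto simp: Pi_def)

locale function_algebra_hom = unital_cstar_algebra +
  fixes N :: "'g set" and C and \<phi>
  assumes N_nonempty: "N \<noteq> {}"
    and C_subalgebra: "cstar_subalgebra (linfty N) C"
    and hom: "\<phi> \<in> cstar_hom ((linfty N)\<lparr>carrier := C\<rparr>) A"
begin

lemmas C_closed = closed_subspaceD[OF cstar_subalgebraD(1)[OF C_subalgebra], simplified]
  cstar_subalgebraD(2,3)[OF C_subalgebra, simplified]

lemmas hom_simps = cstar_homD[OF hom, simplified]

text \<open>
  With \<open>f = 1 - sqrt (1 - d\<^sup>2)\<close> one has \<open>d\<^sup>2 + (1 - f)\<^sup>2 = 1\<close>. The unit need not belong to the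
  domain of \<open>\<phi>\<close>, so this is transported in the form \<open>d\<^sup>2 + f\<^sup>2 = 2 f\<close>.
\<close>

lemma hom_real_bound:
  assumes d: "(\<lambda>y. complex_of_real (r y)) \<in> C" and r: "\<And>y. \<bar>r y\<bar> \<le> 1/2"
  shows "cnorm A (\<phi> (\<lambda>y. complex_of_real (r y))) \<le> 1"
proof -
  note [simp] = one_closed one_mult mult_one mult_closed
  let ?d = "\<lambda>y. complex_of_real (r y)"
  let ?f = "\<lambda>y. complex_of_real (1 - sqrt (1 - (r y)\<^sup>2))"
  have f: "?f \<in> C" by (rule subalgebra_contains_sqrt[OF N_nonempty C_subalgebra d r])
  define T F where "T = \<phi> ?d" and "F = \<phi> ?f"
  have T: "T \<in> carrier A" "star A T = T" and F: "F \<in> carrier A" "star A F = F"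
    using hom_simps(1)[OF d] hom_simps(5)[OF d] hom_simps(1)[OF f] hom_simps(5)[OF f]
    by (simp_all add: T_def F_def)
  have TF: "T \<otimes> F = F \<otimes> T"
    unfolding T_def F_def hom_simps(4)[OF d f, symmetric] hom_simps(4)[OF f d, symmetric]
    by (simp add: mult.commute)
  have "(r y)\<^sup>2 \<le> 1" for y using power_mono[OF r abs_ge_zero, of y 2] by (simp add: power2_eq_square)
  then have "sqrt (1 - (r y)\<^sup>2) * sqrt (1 - (r y)\<^sup>2) = 1 - r y * r y" for y
    by (simp add: power2_eq_square)
  then have "r y * r y + (1 - sqrt (1 - (r y)\<^sup>2)) * (1 - sqrt (1 - (r y)\<^sup>2))
      = (1 - sqrt (1 - (r y)\<^sup>2)) + (1 - sqrt (1 - (r y)\<^sup>2))" for y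
    by (simp add: algebra_simps)
  then have "(\<lambda>y. ?d y * ?d y + ?f y * ?f y) = (\<lambda>y. ?f y + ?f y)"
    unfolding of_real_mult[symmetric] of_real_add[symmetric] by presburger
  then have "\<phi> (\<lambda>y. ?d y * ?d y + ?f y * ?f y) = \<phi> (\<lambda>y. ?f y + ?f y)" by simp
  then have sq: "T \<otimes> T \<oplus> F \<otimes> F = F \<oplus> F"
    using d f C_closed(3,6) by (simp only: hom_simps(2,4) T_def F_def)
  show ?thesis unfolding T_def[symmetric]
  proof (rule norm_le_one_of_squares[OF T])
    show "\<one> \<ominus> F \<in> carrier A" using F by simp
    show "star A (\<one> \<ominus> F) = \<one> \<ominus> F"
      using F star_smult[of F "-1"] by (simp add: minus_eq_smult star_add smult_closed star_one)
    show "T \<otimes> (\<one> \<ominus> F) = (\<one> \<ominus> F) \<otimes> T"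
      using T F TF by (simp add: mult_diff_distrib diff_mult_distrib)
    have "(\<one> \<ominus> F) \<otimes> (\<one> \<ominus> F) = \<one> \<ominus> (F \<oplus> F) \<oplus> F \<otimes> F" using F
      by (simp add: mult_diff_distrib diff_mult_distrib one_mult mult_one one_closed mult_closed)
        (simp add: a_minus_def minus_add one_closed mult_closed a_ac)
    then have "T \<otimes> T \<oplus> (\<one> \<ominus> F) \<otimes> (\<one> \<ominus> F) = \<one> \<ominus> (F \<oplus> F) \<oplus> (T \<otimes> T \<oplus> F \<otimes> F)"
      using T F by (simp add: a_minus_def a_ac)
    also have "\<dots> = \<one>" unfolding sq using F by (simp add: a_minus_def a_assoc l_neg)
    finally show "T \<otimes> T \<oplus> (\<one> \<ominus> F) \<otimes> (\<one> \<ominus> F) = \<one>" .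
  qed
qed

text \<open>
  With \<open>K\<close> the norm of \<open>f\<close>, real and imaginary part are each scaled by \<open>1 / (2 K)\<close> to become
  bounded by \<open>1/2\<close>; the two contributions of \<open>2 K\<close> add up to \<open>4 K\<close>.
\<close>

lemma hom_bound:
  assumes f: "f \<in> C"
  shows "cnorm A (\<phi> f) \<le> 4 * cnorm (linfty N) f"
proof -
  define K where "K = cnorm (linfty N) f"
  have fc: "f \<in> carrier (linfty N)" using f C_closed(1) by blast
  have fK: "cmod (f y) \<le> K" if "y \<in> N" for y using linfty_norm_upper[OF fc that] by (simp add: K_def)
  have f0: "f y = 0" if "y \<notin> N" for y using fc that by (simp add: linfty_carrier_iff)
  have K0: "0 \<le> K" using N_nonempty fK norm_ge_zero order_trans by blast
  show ?thesis
  proof (cases "K = 0")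
    case True
    then have "f y = 0" for y using fK[of y] f0[of y] by (cases "y \<in> N") auto
    then have "f = (\<lambda>y. 0 * f y)" by auto
    from arg_cong[OF this, of \<phi>] have "\<phi> f = 0 \<odot> \<phi> f" by (rule trans) (rule hom_simps(3)[OF f])
    then show ?thesis
      using smult_zero_left[OF hom_simps(1)[OF f]] K0 norm_zero by (simp add: K_def)
  next
    case False
    let ?r = "\<lambda>y. Re (f y) / (2 * K)" and ?s = "\<lambda>y. Im (f y) / (2 * K)"
    let ?d = "\<lambda>y. complex_of_real (?r y)" and ?e = "\<lambda>y. complex_of_real (?s y)"
    have small: "\<bar>x\<bar> / (2 * K) \<le> 1/2" if "\<bar>x\<bar> \<le> K" for x :: real
      using that False K0 by (simp add: field_simps)
    have r: "\<bar>?r y\<bar> \<le> 1/2" and s: "\<bar>?s y\<bar> \<le> 1/2" for y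
      using small[of "Re (f y)"] small[of "Im (f y)"] K0 f0[of y]
        order_trans[OF abs_Re_le_cmod fK[of y]] order_trans[OF abs_Im_le_cmod fK[of y]]
      by (cases "y \<in> N"; simp add: abs_mult)+
    have d_eq: "?d = (\<lambda>y. complex_of_real (1 / (4 * K)) * (f y + cnj (f y)))"
      and e_eq: "?e = (\<lambda>y. (complex_of_real (1 / (4 * K)) * (-\<i>)) * (f y + (-1) * cnj (f y)))"
      using False by (auto simp: complex_eq_iff)
    have d: "?d \<in> C"
      unfolding d_eq by (rule C_closed(4)[OF C_closed(3)[OF f C_closed(7)[OF f]]])
    have e: "?e \<in> C"
      unfolding e_eq by (rule C_closed(4)[OF C_closed(3)[OF f C_closed(4)[OF C_closed(7)[OF f]]]])
    have f_eq: "f = (\<lambda>y. complex_of_real (2 * K) * (?d y + \<i> * ?e y))"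
      using False by (auto simp: complex_eq_iff)
    have "\<phi> f = complex_of_real (2 * K) \<odot> (\<phi> ?d \<oplus> \<i> \<odot> \<phi> ?e)"
      using arg_cong[OF f_eq, of \<phi>] hom_simps(2)[OF d C_closed(4)[OF e]] hom_simps(3)[OF e]
        hom_simps(3)[OF C_closed(3)[OF d C_closed(4)[OF e]]] by (simp only:)
    then have "cnorm A (\<phi> f) = 2 * K * cnorm A (\<phi> ?d \<oplus> \<i> \<odot> \<phi> ?e)"
      using hom_simps(1) d e K0 by (simp add: norm_smult smult_closed norm_mult)
    also have "cnorm A (\<phi> ?d \<oplus> \<i> \<odot> \<phi> ?e) \<le> 2"
      using norm_triangle[of "\<phi> ?d" "\<i> \<odot> \<phi> ?e"] hom_real_bound[OF d r] hom_real_bound[OF e s]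
        hom_simps(1)[OF d] hom_simps(1)[OF e] by (simp add: norm_smult smult_closed)
    finally show ?thesis using K0 by (simp add: K_def mult_left_mono)
  qed
qed

lemma hom_continuous:
  assumes F: "\<And>n. F n \<in> C" and f: "f \<in> C" and lim: "cconv (linfty N) F f"
  shows "cconv A (\<lambda>n. \<phi> (F n)) (\<phi> f)"
proof (rule cconv_dominated)
  show "(\<lambda>n. 4 * cnorm (linfty N) (F n \<ominus>\<^bsub>linfty N\<^esub> f)) \<longlonglongrightarrow> 0"
    using tendsto_mult_right_zero[OF lim[unfolded cconv_def]] .
  fix n
  have "F n \<ominus>\<^bsub>linfty N\<^esub> f = (\<lambda>y. F n y + (-1) * f y)"
    using F f C_closed(1) by (subst linfty_diff) auto
  moreover have "(\<lambda>y. F n y + (-1) * f y) \<in> C" by (intro C_closed(3,4) F f)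
  moreover have "\<phi> (\<lambda>y. F n y + (-1) * f y) = \<phi> (F n) \<ominus> \<phi> f"
    using F f C_closed(4)[OF f, of "-1"] hom_simps(1)[OF F] hom_simps(1)[OF f]
    by (simp only: hom_simps(2,3) minus_eq_smult)
  ultimately show "cnorm A (\<phi> (F n) \<ominus> \<phi> f) \<le> 4 * cnorm (linfty N) (F n \<ominus>\<^bsub>linfty N\<^esub> f)"
    using hom_bound by metis
qed (use F f hom_simps(1) in auto)

end

section \<open>Cosets and conjugates in the semidirect product\<close>

context group
begin

lemma inv_mult_cancel: "\<lbrakk>x \<in> carrier G; y \<in> carrier G\<rbrakk> \<Longrightarrow> inv x \<otimes> (x \<otimes> y) = y"
  by (simp add: m_assoc[symmetric])

lemma mult_inv_cancel: "\<lbrakk>x \<in> carrier G; y \<in> carrier G\<rbrakk> \<Longrightarrow> x \<otimes> (inv x \<otimes> y) = y"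
  by (simp add: m_assoc[symmetric])

lemmas word_simps = m_assoc inv_mult_group inv_mult_cancel mult_inv_cancel

lemma mem_l_coset_iff:
  assumes "x \<in> carrier G" "U \<subseteq> carrier G"
  shows "y \<in> x <# U \<longleftrightarrow> y \<in> carrier G \<and> inv x \<otimes> y \<in> U"
proof
  assume "y \<in> x <# U"
  then show "y \<in> carrier G \<and> inv x \<otimes> y \<in> U" using assms by (auto simp: l_coset_def inv_mult_cancel subset_iff)
next
  assume y: "y \<in> carrier G \<and> inv x \<otimes> y \<in> U"
  then have "y = x \<otimes> (inv x \<otimes> y)" using assms by (simp add: mult_inv_cancel)
  then show "y \<in> x <# U" using y unfolding l_coset_def by blast
qed

lemma mem_conj_set_iff:
  assumes "a \<in> carrier G" "U \<subseteq> carrier G"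
  shows "y \<in> conj_set G a U \<longleftrightarrow> y \<in> carrier G \<and> inv a \<otimes> y \<otimes> a \<in> U"
proof
  assume "y \<in> conj_set G a U"
  then obtain m where m: "m \<in> U" "y = a \<otimes> m \<otimes> inv a"
    unfolding conj_set_def l_coset_def r_coset_def by blast
  moreover have "m \<in> carrier G" using m assms by blast
  ultimately show "y \<in> carrier G \<and> inv a \<otimes> y \<otimes> a \<in> U" using assms by (simp add: word_simps)
next
  assume y: "y \<in> carrier G \<and> inv a \<otimes> y \<otimes> a \<in> U"
  then have "y = a \<otimes> (inv a \<otimes> y \<otimes> a) \<otimes> inv a" using assms by (simp add: word_simps)
  then show "y \<in> conj_set G a U" using y unfolding conj_set_def l_coset_def r_coset_def by blast
qed

lemma l_cosets_eq_or_disjoint: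
  assumes V: "subgroup V G" and x: "x \<in> carrier G" and y: "y \<in> carrier G"
    and ne: "(x <# V) \<inter> (y <# V) \<noteq> {}"
  shows "x <# V = y <# V"
  using ne l_repr_independence[OF _ x V] l_repr_independence[OF _ y V] by blast

end

context semidirect_setting
begin

lemma N_subgroup: "subgroup N G"
  using N_normal normal_imp_subgroup by blast

lemma M_subgroup: "subgroup M G"
  using incl_subgroup[OF N_subgroup] M_normal normal_imp_subgroup by blast

lemma M_subset_N: "M \<subseteq> N"
  using subgroup.subset[OF normal_imp_subgroup[OF M_normal]] by simp

lemma N_carrier: "n \<in> N \<Longrightarrow> n \<in> carrier G"
  and H_carrier: "a \<in> H \<Longrightarrow> a \<in> carrier G"
  and M_carrier: "m \<in> M \<Longrightarrow> m \<in> carrier G"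
  and H_plus_H: "a \<in> H_plus G H M \<Longrightarrow> a \<in> H"
  using N_subgroup H_subgroup M_subgroup by (auto simp: subgroup.mem_carrier H_plus_def)

lemma M_subset_carrier: "M \<subseteq> carrier G"
  using M_carrier by blast

lemmas subgroup_simps =
  subgroup.m_closed[OF N_subgroup] subgroup.m_inv_closed[OF N_subgroup] subgroup.one_closed[OF N_subgroup]
  subgroup.m_closed[OF H_subgroup] subgroup.m_inv_closed[OF H_subgroup] subgroup.one_closed[OF H_subgroup]
  subgroup.m_closed[OF M_subgroup] subgroup.m_inv_closed[OF M_subgroup] subgroup.one_closed[OF M_subgroup]

lemma N_conj_closed: "\<lbrakk>g \<in> carrier G; n \<in> N\<rbrakk> \<Longrightarrow> g \<otimes> n \<otimes> inv g \<in> N"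
  using normal.inv_op_closed2[OF N_normal] .

lemma M_conj_closed:
  assumes "n \<in> N" "m \<in> M" shows "n \<otimes> m \<otimes> inv n \<in> M"
proof -
  have "inv\<^bsub>G\<lparr>carrier := N\<rparr>\<^esub> n = inv n" using m_inv_consistent[OF N_subgroup assms(1)] .
  then show ?thesis using normal.inv_op_closed2[OF M_normal, of n m] assms by simp
qed

lemma conj_set_H:
  assumes a: "a \<in> H"
  shows "subgroup (conj_set G a M) G"
    and "conj_set G a M \<subseteq> N"
    and "\<lbrakk>n \<in> N; v \<in> conj_set G a M\<rbrakk> \<Longrightarrow> n \<otimes> v \<otimes> inv n \<in> conj_set G a M"
proof -
  note aG = H_carrier[OF a]
  note iff = mem_conj_set_iff[OF aG M_subset_carrier]
  show "subgroup (conj_set G a M) G"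
  proof (rule subgroupI)
    show "conj_set G a M \<subseteq> carrier G" using iff by blast
    show "conj_set G a M \<noteq> {}" using iff[of \<one>] aG subgroup_simps by auto
    fix x assume x: "x \<in> conj_set G a M"
    then show "inv x \<in> conj_set G a M"
      using aG subgroup_simps(8)[of "inv a \<otimes> x \<otimes> a"] unfolding iff by (auto simp: word_simps)
    fix y assume y: "y \<in> conj_set G a M"
    show "x \<otimes> y \<in> conj_set G a M"
      using x y aG subgroup_simps(7)[of "inv a \<otimes> x \<otimes> a" "inv a \<otimes> y \<otimes> a"] unfolding iff
      by (auto simp: word_simps)
  qed
  show "conj_set G a M \<subseteq> N"
  proof
    fix y assume "y \<in> conj_set G a M"
    then have y: "y \<in> carrier G" "inv a \<otimes> y \<otimes> a \<in> N" using iff M_subset_N by auto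
    then show "y \<in> N" using N_conj_closed[OF aG y(2)] aG by (simp add: word_simps)
  qed
  assume n: "n \<in> N" and v: "v \<in> conj_set G a M"
  have nG: "n \<in> carrier G" using n N_carrier by blast
  have "inv a \<otimes> n \<otimes> a \<in> N" using N_conj_closed[of "inv a" n] aG n by simp
  then show "n \<otimes> v \<otimes> inv n \<in> conj_set G a M"
    using M_conj_closed[of "inv a \<otimes> n \<otimes> a" "inv a \<otimes> v \<otimes> a"] v aG nG unfolding iff
    by (auto simp: word_simps)
qed

lemma conj_set_mem_family: "a \<in> H \<Longrightarrow> conj_set G a M \<in> conj_family G H M"
  by (auto simp: conj_family_def)

lemma conj_set_one: "conj_set G \<one> M = M"
  using mem_conj_set_iff[OF one_closed M_subset_carrier] M_carrier by auto

lemma H_plus_iff: "a \<in> H_plus G H M \<longleftrightarrow> a \<in> H \<and> (\<forall>m\<in>M. a \<otimes> m \<otimes> inv a \<in> M)"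
  unfolding H_plus_def conj_set_def l_coset_def r_coset_def by blast

lemma H_plus_conj: "\<lbrakk>a \<in> H_plus G H M; m \<in> M\<rbrakk> \<Longrightarrow> a \<otimes> m \<otimes> inv a \<in> M"
  using H_plus_iff by blast

lemma H_plus_mult:
  assumes a: "a \<in> H_plus G H M" and b: "b \<in> H_plus G H M"
  shows "a \<otimes> b \<in> H_plus G H M"
proof -
  have "a \<otimes> b \<otimes> m \<otimes> inv (a \<otimes> b) \<in> M" if m: "m \<in> M" for m
    using H_plus_conj[OF a H_plus_conj[OF b m]] H_carrier H_plus_H a b M_carrier[OF m]
    by (simp add: word_simps)
  then show ?thesis using a b H_plus_iff subgroup_simps by simp
qed

text \<open>Since \<open>M\<close> itself belongs to the family of conjugates, small members can be taken inside \<open>M\<close>.\<close>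

lemma exists_H_plus_below:
  assumes b: "b \<in> H"
  obtains c where "c \<in> H_plus G H M" "conj_set G c M \<subseteq> conj_set G b M"
proof -
  obtain W where "W \<in> conj_family G H M" "W \<subseteq> conj_set G \<one> M \<inter> conj_set G b M"
    using filter_base conj_set_mem_family b subgroup_simps(6) by blast
  then show thesis using that by (auto simp: conj_family_def H_plus_def conj_set_one)
qed

text \<open>
  Any \<open>h \<in> H\<close> is a quotient of elements of \<open>H\<^sup>+\<close>: for \<open>b\<close> with
  \<open>b M b\<^sup>-\<^sup>1 \<subseteq> M \<inter> h\<^sup>-\<^sup>1 M h\<close> both \<open>b\<close> and \<open>h b\<close> lie in \<open>H\<^sup>+\<close>, and commutativity gives
  \<open>h = b\<^sup>-\<^sup>1 (h b)\<close>. A factor \<open>y \<in> N\<close> is absorbed by enlarging numerator and denominator by a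
  \<open>d \<in> H\<^sup>+\<close> with \<open>d y d\<^sup>-\<^sup>1 \<in> M\<close>.
\<close>

lemma factorisation:
  assumes comm: "comm_group (G\<lparr>carrier := H\<rparr>)"
    and N_union: "N = (\<Union>a\<in>H_plus G H M. conj_set G (inv a) M)"
    and g: "g \<in> carrier G"
  obtains e m f where "e \<in> H_plus G H M" "m \<in> M" "f \<in> H_plus G H M" "g = inv e \<otimes> m \<otimes> f"
proof -
  have H_comm: "x \<otimes> y = y \<otimes> x" if "x \<in> H" "y \<in> H" for x y
    using comm_groupE(4)[OF comm, of x y] that by simp
  obtain y h where yh: "y \<in> N" "h \<in> H" "g = y \<otimes> h"
    using g N_mult_H unfolding set_mult_def by blast
  obtain b where b: "b \<in> H_plus G H M" "conj_set G b M \<subseteq> conj_set G (inv h) M"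
    using exists_H_plus_below[of "inv h"] yh subgroup_simps by blast
  obtain d where d: "d \<in> H_plus G H M" "y \<in> conj_set G (inv d) M"
    using yh(1) N_union by blast
  note cG = H_carrier[OF yh(2)] H_carrier[OF H_plus_H[OF b(1)]] H_carrier[OF H_plus_H[OF d(1)]] N_carrier[OF yh(1)]
  have hb: "h \<otimes> b \<in> H_plus G H M"
    unfolding H_plus_iff
  proof (intro conjI ballI)
    show "h \<otimes> b \<in> H" using yh H_plus_H[OF b(1)] subgroup_simps by simp
    fix m assume m: "m \<in> M"
    have "b \<otimes> m \<otimes> inv b \<in> conj_set G b M" using m unfolding conj_set_def l_coset_def r_coset_def by blast
    then have "b \<otimes> m \<otimes> inv b \<in> conj_set G (inv h) M" using b(2) by blast
    then show "h \<otimes> b \<otimes> m \<otimes> inv (h \<otimes> b) \<in> M"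
      using mem_conj_set_iff[of "inv h" M] M_subset_carrier M_carrier[OF m] cG by (simp add: word_simps)
  qed
  have dy: "d \<otimes> y \<otimes> inv d \<in> M"
    using d(2) mem_conj_set_iff[of "inv d" M y] M_subset_carrier cG by simp
  show thesis
  proof (rule that)
    show "b \<otimes> d \<in> H_plus G H M" using H_plus_mult b(1) d(1) by blast
    show "d \<otimes> (h \<otimes> b) \<in> H_plus G H M" using H_plus_mult d(1) hb by blast
    show "b \<otimes> (d \<otimes> y \<otimes> inv d) \<otimes> inv b \<in> M" using H_plus_conj[OF b(1) dy] .
    have "inv (b \<otimes> d) \<otimes> (b \<otimes> (d \<otimes> y \<otimes> inv d) \<otimes> inv b) \<otimes> (d \<otimes> (h \<otimes> b))
        = y \<otimes> (inv (b \<otimes> d) \<otimes> (d \<otimes> (h \<otimes> b)))"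
      using cG by (simp add: word_simps)
    also have "inv (b \<otimes> d) \<otimes> (d \<otimes> (h \<otimes> b)) = inv (d \<otimes> b) \<otimes> (d \<otimes> (b \<otimes> h))"
      using H_comm[of b d] H_comm[of b h] b(1) d(1) yh(2) H_plus_H by metis
    also have "\<dots> = h" using cG by (simp add: word_simps)
    finally show "g = inv (b \<otimes> d) \<otimes> (b \<otimes> (d \<otimes> y \<otimes> inv d) \<otimes> inv b) \<otimes> (d \<otimes> (h \<otimes> b))"
      using yh(3) by simp
  qed
qed

lemma NH_split_mult:
  assumes x: "x \<in> N" and a: "a \<in> H"
  shows "NH_split G N H (x \<otimes> a) = (x, a)"
proof -
  have uniq: "y = x \<and> b = a" if "y \<in> N" "b \<in> H" "x \<otimes> a = y \<otimes> b" for y b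
  proof -
    note cG = N_carrier[OF x] N_carrier[OF that(1)] H_carrier[OF a] H_carrier[OF that(2)]
    have "inv y \<otimes> x = inv y \<otimes> (x \<otimes> a) \<otimes> inv a" using cG by (simp add: word_simps)
    also have "\<dots> = b \<otimes> inv a" using cG by (simp add: that(3) word_simps)
    finally have eq: "inv y \<otimes> x = b \<otimes> inv a" .
    moreover have "inv y \<otimes> x \<in> N" "b \<otimes> inv a \<in> H" using x a that subgroup_simps by simp_all
    ultimately have "inv y \<otimes> x = \<one>" "b \<otimes> inv a = \<one>" using N_Int_H by auto
    then show ?thesis using cG by (metis inv_equality inv_inv inv_closed r_inv l_inv inv_solve_right' l_one)
  qed
  show ?thesis unfolding NH_split_def
    by (rule the_equality) (use x a uniq in auto)
qed

lemma \<alpha>_act_charfun: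
  assumes x: "x \<in> N" and a: "a \<in> H"
  shows "\<alpha>_act G N H (x \<otimes> a) (charfun M) = charfun (x <# conj_set G a M)"
proof
  fix y
  note cG = N_carrier[OF x] H_carrier[OF a]
  show "\<alpha>_act G N H (x \<otimes> a) (charfun M) y = charfun (x <# conj_set G a M) y"
  proof (cases "y \<in> N")
    case True
    note yG = N_carrier[OF True]
    have "inv (x \<otimes> a) = (inv a \<otimes> inv x \<otimes> a) \<otimes> inv a" using cG by (simp add: word_simps)
    moreover have "inv a \<otimes> inv x \<otimes> a \<in> N"
      using N_conj_closed[of "inv a" "inv x"] cG x subgroup_simps by simp
    ultimately have "NH_split G N H (inv (x \<otimes> a)) = (inv a \<otimes> inv x \<otimes> a, inv a)"
      using NH_split_mult a subgroup_simps by simp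
    then have "\<beta>_act G N H (inv (x \<otimes> a)) y = inv a \<otimes> (inv x \<otimes> y) \<otimes> a"
      using cG yG by (simp add: \<beta>_act_def word_simps)
    moreover have "y \<in> x <# conj_set G a M \<longleftrightarrow> inv a \<otimes> (inv x \<otimes> y) \<otimes> a \<in> M"
      using cG yG mem_l_coset_iff[OF cG(1) subgroup.subset[OF conj_set_H(1)[OF a]]]
        mem_conj_set_iff[OF cG(2) M_subset_carrier] by simp
    ultimately show ?thesis using True by (simp add: \<alpha>_act_def charfun_def)
  next
    case False
    have "y \<notin> x <# conj_set G a M"
      using False x conj_set_H(2)[OF a] subgroup_simps unfolding l_coset_def by blast
    then show ?thesis using False by (simp add: \<alpha>_act_def charfun_def)
  qed
qed

lemma M_cosets:
  "lcosets\<^bsub>G\<lparr>carrier := M\<rparr>\<^esub> V = (\<lambda>m. m <# V) ` M"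
  by (auto simp: LCOSETS_def l_coset_def)

text \<open>
  The quotient group is made of right cosets; conjugates of \<open>M\<close> are normal in \<open>N\<close>, so these are
  the left cosets too.
\<close>

lemma finite_cosets:
  assumes a: "a \<in> H" and b: "b \<in> H" and sub: "conj_set G b M \<subseteq> conj_set G a M"
  shows "finite ((\<lambda>v. v <# conj_set G b M) ` conj_set G a M)"
proof -
  let ?V = "conj_set G b M"
  have "v <# ?V = ?V #> v" if v: "v \<in> conj_set G a M" for v
  proof -
    have vN: "v \<in> N" using v conj_set_H(2)[OF a] by blast
    note cG = N_carrier[OF vN]
    note VG = subgroup.mem_carrier[OF conj_set_H(1)[OF b]]
    have "v \<otimes> w \<in> ?V #> v" if w: "w \<in> ?V" for w
    proof -
      have "v \<otimes> w = (v \<otimes> w \<otimes> inv v) \<otimes> v" using cG VG[OF w] by (simp add: word_simps)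
      then show ?thesis using conj_set_H(3)[OF b vN w] unfolding r_coset_def by blast
    qed
    moreover have "w \<otimes> v \<in> v <# ?V" if w: "w \<in> ?V" for w
    proof -
      have "w \<otimes> v = v \<otimes> (inv v \<otimes> w \<otimes> inv (inv v))" using cG VG[OF w] by (simp add: word_simps)
      then show ?thesis
        using conj_set_H(3)[OF b subgroup_simps(2)[OF vN] w] unfolding l_coset_def by blast
    qed
    ultimately show ?thesis
      by (auto simp: l_coset_def[of G v] r_coset_def[of G _ v])
  qed
  then have "(\<lambda>v. v <# ?V) ` conj_set G a M = carrier (G\<lparr>carrier := conj_set G a M\<rparr> Mod ?V)"
    by (auto simp: FactGroup_def RCOSETS_def r_coset_def)
  then show ?thesis
    using finite_quotients[OF conj_set_mem_family[OF a] conj_set_mem_family[OF b] sub] by simp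
qed

end

section \<open>The SU-family in the corner\<close>

text \<open>
  \<open>B\<close> stands for the multiplier algebra and \<open>I\<close> for the crossed product inside it. Arguing
  with an arbitrary closed *-ideal keeps double centralisers out of the computations.
\<close>

locale covariant_corner = semidirect_setting G N H M
    + B: function_algebra_hom B N "carrier (D_alg G N H M)" iD
  for G :: "('g, 'k) monoid_scheme" (structure) and N H M
    and B :: "('b, 'n) cstar_alg_scheme" and iD +
  fixes iG :: "'g \<Rightarrow> 'b" and I :: "'b set" and s u :: "'g \<Rightarrow> 'b"
  assumes iG_unitary: "g \<in> carrier G \<Longrightarrow> cunitary B (iG g)"
    and iG_mult: "\<lbrakk>g \<in> carrier G; h \<in> carrier G\<rbrakk> \<Longrightarrow> iG (g \<otimes> h) = iG g \<otimes>\<^bsub>B\<^esub> iG h"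
    and covariance: "\<lbrakk>g \<in> carrier G; d \<in> carrier (D_alg G N H M)\<rbrakk>
      \<Longrightarrow> iD (\<alpha>_act G N H g d) = iG g \<otimes>\<^bsub>B\<^esub> iD d \<otimes>\<^bsub>B\<^esub> star B (iG g)"
    and I_span: "closed_span B {iD d \<otimes>\<^bsub>B\<^esub> iG g | d g. d \<in> carrier (D_alg G N H M) \<and> g \<in> carrier G} = I"
    and I_ideal: "\<lbrakk>t \<in> carrier B; x \<in> I\<rbrakk> \<Longrightarrow> t \<otimes>\<^bsub>B\<^esub> x \<in> I \<and> x \<otimes>\<^bsub>B\<^esub> t \<in> I"
    and I_star: "x \<in> I \<Longrightarrow> star B x \<in> I"
    and s_eq: "a \<in> H_plus G H M \<Longrightarrow> s a = iD (charfun M) \<otimes>\<^bsub>B\<^esub> iG a \<otimes>\<^bsub>B\<^esub> iD (charfun M)"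
    and u_eq: "m \<in> M \<Longrightarrow> u m = iD (charfun M) \<otimes>\<^bsub>B\<^esub> iG m \<otimes>\<^bsub>B\<^esub> iD (charfun M)"
begin

abbreviation bmult (infixl "\<cdot>" 70) where "x \<cdot> y \<equiv> x \<otimes>\<^bsub>B\<^esub> y"

abbreviation D where "D \<equiv> carrier (D_alg G N H M)"

abbreviation P where "P \<equiv> iD (charfun M)"

definition cor where "cor = B\<lparr>carrier := (\<lambda>x. P \<cdot> x \<cdot> P) ` I, one := P\<rparr>"

lemma cor_sel [simp]:
  "mult cor = mult B" "one cor = P" "add cor = add B" "zero cor = zero B"
  "smult cor = smult B" "star cor = star B" "cnorm cor = cnorm B"
  by (simp_all add: cor_def)

lemma charfun_coset_D:
  assumes "x \<in> N" "a \<in> H" shows "charfun (x <# conj_set G a M) \<in> D"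
  using cstar_generatedI[of "charfun (x <# conj_set G a M)" "{charfun (x <# U) | x U. x \<in> N \<and> U \<in> conj_family G H M}" "linfty N"]
    assms conj_set_mem_family by (auto simp: D_alg_def)

lemma M_coset: "m \<in> M \<Longrightarrow> m <# M = M"
  using coset_join3[OF M_carrier M_subgroup] by blast

lemma charfun_M_D: "charfun M \<in> D"
  using charfun_coset_D[of \<one> \<one>] subgroup_simps by (simp add: conj_set_one M_coset)

lemma P_closed: "P \<in> carrier B" and P_star: "star B P = P" and P_idem: "P \<cdot> P = P"
proof -
  have "(\<lambda>y. cnj (charfun M y)) = charfun M" by (auto simp: charfun_def)
  then show "P \<in> carrier B" "star B P = P" "P \<cdot> P = P"
    using B.hom_simps(1)[OF charfun_M_D] B.hom_simps(5)[OF charfun_M_D]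
      B.hom_simps(4)[OF charfun_M_D charfun_M_D] by (simp_all add: charfun_Int[symmetric])
qed

lemma iG_closed: "g \<in> carrier G \<Longrightarrow> iG g \<in> carrier B"
  using iG_unitary by (simp add: cunitary_def)

lemma iG_one: "iG \<one> = \<one>\<^bsub>B\<^esub>"
proof -
  have e: "iG \<one> \<in> carrier B" "star B (iG \<one>) \<cdot> iG \<one> = \<one>\<^bsub>B\<^esub>"
    using iG_unitary[OF one_closed] by (simp_all add: cunitary_def)
  have "iG \<one> = star B (iG \<one>) \<cdot> iG \<one> \<cdot> iG \<one>" using e B.one_mult by simp
  also have "\<dots> = star B (iG \<one>) \<cdot> (iG \<one> \<cdot> iG \<one>)"
    by (rule B.mult_assoc) (use e B.star_closed in auto)
  also have "iG \<one> \<cdot> iG \<one> = iG \<one>" using iG_mult[of \<one> \<one>] by simp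
  finally show ?thesis using e by simp
qed

lemma star_iG: assumes g: "g \<in> carrier G" shows "star B (iG g) = iG (inv g)"
proof -
  have e: "iG g \<in> carrier B" "star B (iG g) \<cdot> iG g = \<one>\<^bsub>B\<^esub>"
    using iG_unitary[OF g] by (simp_all add: cunitary_def)
  have "iG g \<cdot> iG (inv g) = \<one>\<^bsub>B\<^esub>" using iG_mult[of g "inv g"] g by (simp add: iG_one)
  then have "star B (iG g) = star B (iG g) \<cdot> (iG g \<cdot> iG (inv g))"
    using e by (simp add: B.mult_one B.star_closed)
  also have "\<dots> = star B (iG g) \<cdot> iG g \<cdot> iG (inv g)"
    using B.mult_assoc[of "star B (iG g)" "iG g" "iG (inv g)"] e iG_closed g by (simp add: B.star_closed)
  also have "\<dots> = iG (inv g)" using e iG_closed g by (simp add: B.one_mult)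
  finally show ?thesis .
qed

lemma iG_iG: "\<lbrakk>g \<in> carrier G; h \<in> carrier G\<rbrakk> \<Longrightarrow> iG g \<cdot> iG h = iG (g \<otimes> h)"
  by (simp add: iG_mult)

lemma iG_iG_left: "\<lbrakk>g \<in> carrier G; h \<in> carrier G; x \<in> carrier B\<rbrakk> \<Longrightarrow> iG g \<cdot> (iG h \<cdot> x) = iG (g \<otimes> h) \<cdot> x"
  by (simp add: iG_mult iG_closed B.mult_assoc)

lemma P_P_left: "x \<in> carrier B \<Longrightarrow> P \<cdot> (P \<cdot> x) = P \<cdot> x"
  using B.mult_assoc[OF P_closed P_closed] P_idem by simp

lemmas op_simps = P_closed P_star P_idem P_P_left iG_closed star_iG iG_iG iG_iG_left iG_one
  B.mult_closed B.mult_assoc B.one_mult B.mult_one B.one_closed B.star_closed B.star_mult B.star_star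

text \<open>
  This is covariance at \<open>d = p\<close>, since \<open>\<alpha>\<close> moves the characteristic function of \<open>M\<close> to that of a coset.
\<close>

lemma iD_coset:
  assumes x: "x \<in> N" and a: "a \<in> H"
  shows "iD (charfun (x <# conj_set G a M)) = iG (x \<otimes> a) \<cdot> P \<cdot> iG (inv (x \<otimes> a))"
  using covariance[OF _ charfun_M_D, of "x \<otimes> a"] N_carrier[OF x] H_carrier[OF a]
  by (simp add: \<alpha>_act_charfun[OF x a] star_iG)

lemma iG_M_commute: assumes m: "m \<in> M" shows "P \<cdot> iG m = iG m \<cdot> P"
proof -
  have mG: "m \<in> carrier G" "m \<in> N" using m M_carrier M_subset_N by auto
  have "P = iG m \<cdot> P \<cdot> iG (inv m)"
    using iD_coset[OF mG(2) subgroup_simps(6)] mG by (simp add: conj_set_one M_coset m)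
  then have "P \<cdot> iG m = iG m \<cdot> P \<cdot> iG (inv m) \<cdot> iG m" by simp
  then show ?thesis using mG by (simp add: op_simps)
qed

text \<open>
  The projection \<open>a p a\<^sup>-\<^sup>1\<close> is the characteristic function of \<open>a M a\<^sup>-\<^sup>1 \<subseteq> M\<close>, so it lies under \<open>p\<close>.
\<close>

lemma iG_H_plus_absorb:
  assumes a: "a \<in> H_plus G H M" shows "P \<cdot> (iG a \<cdot> P) = iG a \<cdot> P"
proof -
  have aH: "a \<in> H" "a \<in> carrier G" using a H_plus_H H_carrier by auto
  let ?V = "\<one> <# conj_set G a M"
  have V: "charfun ?V \<in> D" using charfun_coset_D aH subgroup_simps by simp
  have "?V = conj_set G a M"
    using lcos_mult_one subgroup.subset[OF conj_set_H(1)[OF aH(1)]] by blast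
  then have "M \<inter> ?V = ?V" using a by (auto simp: H_plus_def)
  then have "P \<cdot> iD (charfun ?V) = iD (charfun ?V)"
    using B.hom_simps(4)[OF charfun_M_D V] by (simp add: charfun_Int[symmetric])
  then have "P \<cdot> (iG a \<cdot> P \<cdot> iG (inv a)) \<cdot> iG a = iG a \<cdot> P \<cdot> iG (inv a) \<cdot> iG a"
    using iD_coset[OF subgroup_simps(3) aH(1)] aH by simp
  then show ?thesis using aH by (simp add: op_simps)
qed

lemma iG_H_plus_absorb_star:
  assumes a: "a \<in> H_plus G H M" shows "P \<cdot> (iG (inv a) \<cdot> P) = P \<cdot> iG (inv a)"
  using arg_cong[OF iG_H_plus_absorb[OF a], of "star B"] H_carrier[OF H_plus_H[OF a]]
  by (simp add: op_simps)

lemma s_simp: "a \<in> H_plus G H M \<Longrightarrow> s a = iG a \<cdot> P"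
  using s_eq H_carrier[OF H_plus_H] by (simp add: op_simps iG_H_plus_absorb)

lemma star_s: "a \<in> H_plus G H M \<Longrightarrow> star B (s a) = P \<cdot> iG (inv a)"
  using s_simp H_carrier[OF H_plus_H] by (simp add: op_simps)

lemma u_simp: "m \<in> M \<Longrightarrow> u m = iG m \<cdot> P"
proof -
  assume m: "m \<in> M"
  have "P \<cdot> iG m \<cdot> P = iG m \<cdot> P \<cdot> P" using iG_M_commute[OF m] by simp
  then show "u m = iG m \<cdot> P" using u_eq[OF m] M_carrier[OF m] by (simp add: op_simps)
qed

lemma u_simp': "m \<in> M \<Longrightarrow> u m = P \<cdot> iG m"
  using u_simp iG_M_commute by simp

lemma closed_subspace_I: "closed_subspace B I"
proof -
  have "{iD d \<cdot> iG g | d g. d \<in> D \<and> g \<in> carrier G} \<subseteq> carrier B"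
    using B.hom_simps(1) iG_closed B.mult_closed by auto
  from closed_subspace_closed_span[OF B.closed_subspace_carrier this] show ?thesis
    unfolding I_span .
qed

lemmas I_closed = closed_subspaceD[OF closed_subspace_I]

lemma iD_iG_I: "\<lbrakk>d \<in> D; g \<in> carrier G\<rbrakk> \<Longrightarrow> iD d \<cdot> iG g \<in> I"
  unfolding I_span[symmetric] by (rule closed_spanI) blast

lemma iD_I: "d \<in> D \<Longrightarrow> iD d \<in> I"
  using iD_iG_I[of d \<one>] B.hom_simps(1) by (simp add: iG_one B.mult_one)

lemma cor_subalgebra: "cstar_subalgebra B (carrier cor)"
  and mem_cor_iff: "x \<in> carrier cor \<longleftrightarrow> x \<in> I \<and> P \<cdot> x = x \<and> x \<cdot> P = x"
  using B.cstar_subalgebra_corner[OF closed_subspace_I I_ideal I_star P_closed P_idem P_star]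
  by (simp_all add: cor_def)

lemma P_cor: "P \<in> carrier cor"
  unfolding mem_cor_iff using iD_I[OF charfun_M_D] P_idem by simp

lemma cor_unital: "unital_cstar_algebra cor"
proof -
  have cor_eq: "B\<lparr>carrier := carrier cor, one := P\<rparr> = cor" by (simp add: cor_def)
  have "unital_cstar_algebra (B\<lparr>carrier := carrier cor, one := P\<rparr>)"
    by (rule B.unital_cstar_algebra_subalgebra[OF cor_subalgebra P_cor]) (simp add: mem_cor_iff)
  then show ?thesis unfolding cor_eq .
qed

lemma compress_cor: "x \<in> I \<Longrightarrow> P \<cdot> x \<cdot> P \<in> carrier cor"
  by (simp add: cor_def)

lemma s_cor: assumes a: "a \<in> H_plus G H M" shows "s a \<in> carrier cor"
proof -
  have "s a \<in> I" using I_ideal[OF iG_closed iD_I[OF charfun_M_D]] s_simp a H_carrier H_plus_H by simp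
  then show ?thesis
    unfolding mem_cor_iff using s_simp[OF a] H_carrier[OF H_plus_H[OF a]]
    by (simp add: op_simps iG_H_plus_absorb[OF a])
qed

lemma u_cor: assumes m: "m \<in> M" shows "u m \<in> carrier cor"
proof -
  have "u m \<in> I" using iD_iG_I[OF charfun_M_D M_carrier[OF m]] u_simp'[OF m] by simp
  moreover have "P \<cdot> u m = u m" using u_simp'[OF m] M_carrier[OF m] by (simp add: op_simps)
  moreover have "u m \<cdot> P = u m" using u_simp[OF m] M_carrier[OF m] by (simp add: op_simps)
  ultimately show ?thesis unfolding mem_cor_iff by blast
qed

text \<open>
  A summand of the SU-relation over cosets is the projection of its coset; this is
  also how projections below \<open>p\<close> are found in the generated algebra.
\<close>

lemma coset_term:
  assumes a: "a \<in> H_plus G H M" and m: "m \<in> M"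
  shows "u m \<cdot> s a \<cdot> star B (s a) \<cdot> u (inv m) = iD (charfun (m <# conj_set G a M))"
proof -
  have cG: "a \<in> carrier G" "m \<in> carrier G" "inv m \<in> M" "m \<in> N"
    using a m H_carrier H_plus_H M_carrier M_subset_N subgroup_simps by auto
  have "u m \<cdot> s a \<cdot> star B (s a) \<cdot> u (inv m)
      = iG m \<cdot> P \<cdot> (iG a \<cdot> P) \<cdot> (P \<cdot> iG (inv a)) \<cdot> (P \<cdot> iG (inv m))"
    by (simp only: star_s[OF a]) (simp only: u_simp[OF m] u_simp'[OF cG(3)] s_simp[OF a])
  also have "\<dots> = iG m \<cdot> (P \<cdot> (iG a \<cdot> P)) \<cdot> ((P \<cdot> (iG (inv a) \<cdot> P)) \<cdot> iG (inv m))"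
    using cG by (simp add: op_simps)
  also have "\<dots> = iG m \<cdot> (iG a \<cdot> P) \<cdot> ((P \<cdot> iG (inv a)) \<cdot> iG (inv m))"
    by (simp only: iG_H_plus_absorb[OF a] iG_H_plus_absorb_star[OF a])
  also have "\<dots> = iG (m \<otimes> a) \<cdot> P \<cdot> iG (inv (m \<otimes> a))"
    using cG by (simp add: op_simps inv_mult_group)
  finally show ?thesis using iD_coset[OF cG(4) H_plus_H[OF a]] by simp
qed

lemma coset_family_disjoint:
  assumes a: "a \<in> H" and X: "X \<subseteq> carrier G"
  shows "pairwise disjnt ((\<lambda>x. x <# conj_set G a M) ` X)"
proof (rule pairwise_imageI)
  fix x y assume "x \<in> X" "y \<in> X" "x <# conj_set G a M \<noteq> y <# conj_set G a M"
  then show "disjnt (x <# conj_set G a M) (y <# conj_set G a M)"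
    using l_cosets_eq_or_disjoint[OF conj_set_H(1)[OF a], of x y] X unfolding disjnt_def by blast
qed

lemma coset_family_Union:
  assumes a: "a \<in> H" and b: "b \<in> H" and x: "x \<in> carrier G" and sub: "conj_set G b M \<subseteq> conj_set G a M"
  shows "\<Union>((\<lambda>v. x \<otimes> v <# conj_set G b M) ` conj_set G a M) = x <# conj_set G a M"
proof -
  let ?U = "conj_set G a M" and ?V = "conj_set G b M"
  note U = conj_set_H(1)[OF a] and V = conj_set_H(1)[OF b]
  note UG = subgroup.mem_carrier[OF U]
  have "y \<in> x \<otimes> v <# ?V" if "v \<in> ?U" "y = x \<otimes> v" for v y
    using that x UG mem_l_coset_iff[of "x \<otimes> v" ?V y] subgroup.subset[OF V] subgroup.one_closed[OF V] by simp
  moreover have "x \<otimes> v \<otimes> w \<in> x <# ?U" if "v \<in> ?U" "w \<in> ?V" for v w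
    using subgroup.m_closed[OF U that(1)] that sub UG x
    by (auto simp: m_assoc l_coset_def)
  ultimately show ?thesis by (auto simp: l_coset_def[of G x] l_coset_def[of G "x \<otimes> _"])
qed

lemma finsum_charfun:
  assumes "finite \<F>" "pairwise disjnt \<F>"
    and "\<And>S. S \<in> \<F> \<Longrightarrow> charfun S \<in> D \<and> iD (charfun S) \<in> carrier cor"
  shows "finsum cor (\<lambda>S. iD (charfun S)) \<F> = iD (charfun (\<Union>\<F>))"
  using assms
proof (induction \<F> rule: finite_induct)
  case empty
  interpret C: unital_cstar_algebra cor by (rule cor_unital)
  have "iD (\<lambda>y. 0) = \<zero>\<^bsub>B\<^esub>"
    using B.hom_simps(3)[OF charfun_M_D, of 0] B.smult_zero_left[OF P_closed] by simp
  then show ?case using C.finsum_empty by (simp add: charfun_empty)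
next
  case (insert S \<F>)
  interpret C: unital_cstar_algebra cor by (rule cor_unital)
  have "S \<inter> \<Union>\<F> = {}" using insert by (auto simp: pairwise_insert disjnt_def)
  moreover have "charfun (\<Union>\<F>) \<in> D"
    by (rule charfun_Union_mem[OF cstar_subalgebraD(1)[OF B.C_subalgebra]])
      (use insert in \<open>auto simp: pairwise_insert\<close>)
  ultimately have "iD (charfun (\<Union>(insert S \<F>))) = iD (charfun S) \<oplus>\<^bsub>B\<^esub> iD (charfun (\<Union>\<F>))"
    using insert.prems(2)[of S] B.hom_simps(2) by (simp add: charfun_Un_disjoint)
  moreover have "finsum cor (\<lambda>S. iD (charfun S)) \<F> = iD (charfun (\<Union>\<F>))"
    using insert by (simp add: pairwise_insert)
  moreover have "finsum cor (\<lambda>S. iD (charfun S)) (insert S \<F>)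
      = iD (charfun S) \<oplus>\<^bsub>cor\<^esub> finsum cor (\<lambda>S. iD (charfun S)) \<F>"
    by (rule C.finsum_insert) (use insert in auto)
  ultimately show ?case by simp
qed

lemma SU_relation_sum:
  assumes a: "a \<in> H_plus G H M"
    and r: "\<And>C. C \<in> lcosets\<^bsub>G\<lparr>carrier := M\<rparr>\<^esub> (conj_set G a M) \<Longrightarrow> r C \<in> C"
  shows "finsum cor (\<lambda>C. u (r C) \<cdot> s a \<cdot> star B (s a) \<cdot> u (inv (r C)))
    (lcosets\<^bsub>G\<lparr>carrier := M\<rparr>\<^esub> (conj_set G a M)) = P"
proof -
  interpret C: unital_cstar_algebra cor by (rule cor_unital)
  let ?V = "conj_set G a M"
  let ?L = "lcosets\<^bsub>G\<lparr>carrier := M\<rparr>\<^esub> ?V"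
  note aH = H_plus_H[OF a] and V = conj_set_H(1)[OF H_plus_H[OF a]]
  have VM: "?V \<subseteq> M" using a by (simp add: H_plus_def)
  have cosets: "r C \<in> M \<and> C = r C <# ?V" if C: "C \<in> ?L" for C
  proof -
    obtain m where m: "m \<in> M" "C = m <# ?V" using C M_cosets by auto
    have rC: "r C \<in> m <# ?V" using r[OF C] m by simp
    then have "r C \<in> M" using m VM subgroup_simps(7) by (auto simp: l_coset_def)
    then show ?thesis using trans[OF m(2) l_repr_independence[OF rC M_carrier[OF m(1)] V]] by blast
  qed
  have term_eq: "u (r C) \<cdot> s a \<cdot> star B (s a) \<cdot> u (inv (r C)) = iD (charfun C)" if "C \<in> ?L" for C
    using coset_term[OF a, of "r C"] cosets[OF that] by simp
  have term_cor: "iD (charfun C) \<in> carrier cor" if "C \<in> ?L" for C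
    unfolding term_eq[OF that, symmetric]
    using C.mult_closed C.star_closed u_cor s_cor[OF a] cosets[OF that] subgroup_simps(8) by simp
  have term_D: "charfun C \<in> D" if "C \<in> ?L" for C
    using cosets[OF that] charfun_coset_D[OF _ aH, of "r C"] M_subset_N by auto
  have "finsum cor (\<lambda>C. u (r C) \<cdot> s a \<cdot> star B (s a) \<cdot> u (inv (r C))) ?L = finsum cor (\<lambda>C. iD (charfun C)) ?L"
    by (rule C.finsum_cong') (use term_eq term_cor in auto)
  also have "\<dots> = iD (charfun (\<Union>?L))"
  proof (rule finsum_charfun)
    show "finite ?L"
      using finite_cosets[OF subgroup_simps(6) aH] VM by (simp add: M_cosets conj_set_one)
    show "pairwise disjnt ?L"
      using coset_family_disjoint[OF aH M_subset_carrier] by (simp add: M_cosets)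
  qed (use term_D term_cor in blast)
  also have "\<Union>?L = M"
  proof -
    have "\<Union>?L = \<one> <# M"
      using coset_family_Union[OF subgroup_simps(6) aH one_closed] VM M_carrier
      by (simp add: M_cosets conj_set_one cong: image_cong_simp)
    then show ?thesis using M_coset subgroup_simps by simp
  qed
  finally show ?thesis by simp
qed

lemma SU_family_corner: "SU_family G H M cor s u"
  unfolding SU_family_def cor_sel
proof (intro conjI ballI allI impI)
  show "unital_cstar_algebra cor" by (rule cor_unital)
  fix a assume a: "a \<in> H_plus G H M"
  note aG = H_carrier[OF H_plus_H[OF a]]
  show "cisometry cor (s a)"
    using s_cor[OF a] aG by (simp add: cisometry_def star_s[OF a]) (simp add: s_simp[OF a] op_simps)
  show "s a \<cdot> s b = s (a \<otimes> b)" if b: "b \<in> H_plus G H M" for b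
    using aG H_carrier[OF H_plus_H[OF b]]
    by (simp add: s_simp[OF a] s_simp[OF b] s_simp[OF H_plus_mult[OF a b]] op_simps iG_H_plus_absorb[OF b])
  show "s a \<cdot> u m = u (a \<otimes> m \<otimes> inv a) \<cdot> s a" if m: "m \<in> M" for m
  proof -
    have "P \<cdot> (iG m \<cdot> P) = iG m \<cdot> P"
      using u_cor[OF m] mem_cor_iff u_simp[OF m] by metis
    then show ?thesis
      using aG M_carrier[OF m] 
      by (simp only: s_simp[OF a] u_simp[OF m] u_simp[OF H_plus_conj[OF a m]])
        (simp add: op_simps iG_H_plus_absorb[OF a] word_simps)
  qed
  show "finsum cor (\<lambda>C. u (r C) \<cdot> s a \<cdot> star B (s a) \<cdot> u (inv (r C)))
      (lcosets\<^bsub>G\<lparr>carrier := M\<rparr>\<^esub> (conj_set G a M)) = P"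
    if "\<forall>C\<in>lcosets\<^bsub>G\<lparr>carrier := M\<rparr>\<^esub> (conj_set G a M). r C \<in> C" for r
    by (rule SU_relation_sum[OF a]) (use that in blast)
next
  fix m assume m: "m \<in> M"
  note mG = M_carrier[OF m]
  have "star B (u m) = P \<cdot> iG (inv m)" using mG by (simp add: u_simp[OF m] op_simps)
  moreover have "star B (u m) = iG (inv m) \<cdot> P"
    using mG by (simp add: u_simp'[OF m] op_simps)
  moreover have "u m \<cdot> (iG (inv m) \<cdot> P) = P"
    using mG by (simp add: u_simp'[OF m] op_simps)
  moreover have "P \<cdot> iG (inv m) \<cdot> u m = P"
    using mG by (simp add: u_simp[OF m] op_simps)
  ultimately show "cunitary cor (u m)"
    using u_cor[OF m] by (simp add: cunitary_def)
  show "u m \<cdot> u k = u (m \<otimes> k)" if k: "k \<in> M" for k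
  proof -
    note kG = M_carrier[OF k] and mk = subgroup_simps(7)[OF m k]
    have "u m \<cdot> u k = P \<cdot> iG m \<cdot> (iG k \<cdot> P)" by (simp only: u_simp'[OF m] u_simp[OF k])
    also have "\<dots> = P \<cdot> iG (m \<otimes> k) \<cdot> P" using mG kG by (simp add: op_simps)
    also have "\<dots> = iG (m \<otimes> k) \<cdot> P \<cdot> P" by (simp only: iG_M_commute[OF mk])
    also have "\<dots> = u (m \<otimes> k)" using mG kG by (simp add: u_simp[OF mk] op_simps)
    finally show ?thesis .
  qed
qed

subsection \<open>Generation of the corner\<close>

abbreviation gen where "gen \<equiv> cstar_generated cor (s ` H_plus G H M \<union> u ` M)"

lemma generators_cor: "s ` H_plus G H M \<union> u ` M \<subseteq> carrier cor"
  using s_cor u_cor by blast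

lemma gen_subalgebra: "cstar_subalgebra cor gen"
proof -
  interpret C: unital_cstar_algebra cor by (rule cor_unital)
  show ?thesis
    by (rule cstar_subalgebra_cstar_generated[OF C.cstar_subalgebra_carrier generators_cor])
qed

lemma gen_subset: "gen \<subseteq> carrier cor"
  using closed_subspaceD(1)[OF cstar_subalgebraD(1)[OF gen_subalgebra]] .

lemmas gen_closed = closed_subspaceD(2-4)[OF cstar_subalgebraD(1)[OF gen_subalgebra], simplified]
  cstar_subalgebraD(2,3)[OF gen_subalgebra, simplified]

lemma gen_limit:
  assumes X: "\<And>n. X n \<in> gen" and x: "x \<in> carrier cor" and lim: "cconv B X x"
  shows "x \<in> gen"
proof -
  have cor_eq: "B\<lparr>carrier := carrier cor, one := P\<rparr> = cor" by (simp add: cor_def)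
  have "X n \<ominus>\<^bsub>cor\<^esub> x = X n \<ominus>\<^bsub>B\<^esub> x" for n
    using B.closed_subspace_group(2)[OF cstar_subalgebraD(1)[OF cor_subalgebra], of "X n" x P] X gen_subset x
    unfolding cor_eq by blast
  then have "cconv cor X x" using lim by (simp add: cconv_def)
  then show ?thesis
    using closed_subspaceD(5)[OF cstar_subalgebraD(1)[OF gen_subalgebra], of X x] X x by blast
qed

text \<open>Compression is continuous, so the two density arguments that follow may pass to limits.\<close>

lemma compress_limit:
  assumes X: "\<And>n. X n \<in> I" "\<And>n. P \<cdot> X n \<cdot> P \<in> gen" and x: "x \<in> I" and lim: "cconv B X x"
  shows "P \<cdot> x \<cdot> P \<in> gen"
proof (rule gen_limit)
  have XB: "X n \<in> carrier B" for n using X(1) I_closed(1) by blast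
  have xB: "x \<in> carrier B" using x I_closed(1) by blast
  have "cconv B (\<lambda>n. P \<cdot> X n) (P \<cdot> x)" by (rule B.cconv_mult_left[OF XB xB lim P_closed])
  then show "cconv B (\<lambda>n. P \<cdot> X n \<cdot> P) (P \<cdot> x \<cdot> P)"
    by (rule B.cconv_mult_right[rotated 2]) (use XB xB P_closed B.mult_closed in auto)
qed (use X compress_cor[OF x] in auto)

text \<open>For \<open>g = e\<^sup>-\<^sup>1 m f\<close> the compression is \<open>s\<^sub>e\<^sup>* u(m) s\<^sub>f\<close>.\<close>

lemma compress_group_element:
  assumes comm: "comm_group (G\<lparr>carrier := H\<rparr>)"
    and N_union: "N = (\<Union>a\<in>H_plus G H M. conj_set G (inv a) M)"
    and g: "g \<in> carrier G"
  shows "P \<cdot> iG g \<cdot> P \<in> gen"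
proof -
  obtain e m f where e: "e \<in> H_plus G H M" and m: "m \<in> M" and f: "f \<in> H_plus G H M"
    and g_eq: "g = inv e \<otimes> m \<otimes> f"
    using factorisation[OF comm N_union g] by blast
  have cG: "e \<in> carrier G" "m \<in> carrier G" "f \<in> carrier G"
    using e m f H_carrier H_plus_H M_carrier by auto
  have "P \<cdot> iG g \<cdot> P = (P \<cdot> iG (inv e)) \<cdot> (iG m \<cdot> (iG f \<cdot> P))"
    using cG by (simp add: g_eq op_simps word_simps)
  also have "iG f \<cdot> P = P \<cdot> (iG f \<cdot> P)" by (rule iG_H_plus_absorb[OF f, symmetric])
  also have "(P \<cdot> iG (inv e)) \<cdot> (iG m \<cdot> (P \<cdot> (iG f \<cdot> P))) = star B (s e) \<cdot> (u m \<cdot> s f)"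
    unfolding star_s[OF e] u_simp[OF m] s_simp[OF f] using cG by (simp add: op_simps)
  also have "\<dots> \<in> gen"
    by (intro gen_closed(4,5) cstar_generatedI) (use e m f in auto)
  finally show ?thesis .
qed

text \<open>
  A coset \<open>y c M c\<^sup>-\<^sup>1\<close> with \<open>c \<in> H\<^sup>+\<close> is either contained in \<open>M\<close>, where its characteristic function is
  \<open>u(y) s\<^sub>c s\<^sub>c\<^sup>* u(y)\<^sup>*\<close>, or disjoint from \<open>M\<close>.
\<close>

lemma compress_small_coset:
  assumes y: "y \<in> N" and c: "c \<in> H_plus G H M"
  shows "P \<cdot> iD (charfun (y <# conj_set G c M)) \<cdot> P \<in> gen"
proof (cases "y \<in> M")
  case True
  have "u y \<cdot> s c \<cdot> star B (s c) \<cdot> u (inv y) \<in> gen"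
    by (intro gen_closed(4,5) cstar_generatedI) (use True c subgroup_simps(8) in auto)
  then have Q: "iD (charfun (y <# conj_set G c M)) \<in> gen" using coset_term[OF c True] by simp
  then have "iD (charfun (y <# conj_set G c M)) \<in> carrier cor" using gen_subset by blast
  then show ?thesis using Q by (simp add: mem_cor_iff)
next
  case False
  note cH = H_plus_H[OF c]
  have "M \<inter> (y <# conj_set G c M) = {}"
  proof (rule ccontr)
    assume "\<not> ?thesis"
    then obtain v where v: "v \<in> conj_set G c M" "y \<otimes> v \<in> M" by (auto simp: l_coset_def)
    then have vM: "v \<in> M" using c by (auto simp: H_plus_def)
    have "y = y \<otimes> v \<otimes> inv v" using M_carrier[OF vM] N_carrier[OF y] by (simp add: word_simps)
    then show False using False subgroup_simps(7)[OF v(2) subgroup_simps(8)[OF vM]] by simp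
  qed
  then have "P \<cdot> iD (charfun (y <# conj_set G c M)) = iD (\<lambda>z. 0)"
    using B.hom_simps(4)[OF charfun_M_D charfun_coset_D[OF y cH]]
    by (simp add: charfun_Int[symmetric] charfun_empty)
  also have "\<dots> = \<zero>\<^bsub>B\<^esub>"
    using B.hom_simps(3)[OF charfun_M_D, of 0] B.smult_zero_left[OF P_closed] by simp
  finally show ?thesis using gen_closed(1) P_closed by (simp add: B.mult_zero_left)
qed

text \<open>
  Compression by \<open>p\<close> is multiplicative on \<open>D\<close>, since \<open>D\<close> is commutative. Hence the functions with
  compression in the generated algebra form a C*-subalgebra; to see that it is closed one
  needs the continuity of \<open>i\<^sub>D\<close>.
\<close>

lemma compress_function:
  assumes d: "d \<in> D" shows "P \<cdot> iD d \<cdot> P \<in> gen"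
proof -
  let ?E = "{d \<in> D. P \<cdot> iD d \<cdot> P \<in> gen}"
  have commute: "P \<cdot> iD f = iD f \<cdot> P" if "f \<in> D" for f
    using B.hom_simps(4)[OF charfun_M_D that] B.hom_simps(4)[OF that charfun_M_D] by (simp add: mult.commute)
  have sub: "closed_subspace (linfty N) ?E"
    unfolding closed_subspace_def
  proof (intro conjI ballI allI impI)
    show "?E \<subseteq> carrier (linfty N)" using B.C_closed(1) by blast
    have "iD (\<lambda>z. 0) = \<zero>\<^bsub>B\<^esub>"
      using B.hom_simps(3)[OF charfun_M_D, of 0] B.smult_zero_left[OF P_closed] by simp
    then show "\<zero>\<^bsub>linfty N\<^esub> \<in> ?E"
      using B.C_closed(2) gen_closed(1) P_closed by (simp add: B.mult_zero_left B.mult_zero_right)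
    fix f assume f: "f \<in> ?E"
    note fB = B.hom_simps(1)[of f]
    show "c \<odot>\<^bsub>linfty N\<^esub> f \<in> ?E" for c
      using f B.C_closed(4)[of f c] B.hom_simps(3)[of f c] gen_closed(3)[of "P \<cdot> iD f \<cdot> P" c] fB P_closed
      by (simp add: B.smult_mult_left B.smult_mult_right B.mult_closed)
    fix h assume h: "h \<in> ?E"
    show "f \<oplus>\<^bsub>linfty N\<^esub> h \<in> ?E"
      using f h B.C_closed(3)[of f h] B.hom_simps(2)[of f h] fB B.hom_simps(1)[of h] P_closed
        gen_closed(2)[of "P \<cdot> iD f \<cdot> P" "P \<cdot> iD h \<cdot> P"]
      by (simp add: B.distrib_left B.distrib_right B.mult_closed)
  next
    fix F f assume F: "(\<forall>n. F n \<in> ?E) \<and> f \<in> carrier (linfty N) \<and> cconv (linfty N) F f"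
    then have FE: "F n \<in> D" "P \<cdot> iD (F n) \<cdot> P \<in> gen" for n by auto
    have f: "f \<in> D" using B.C_closed(5)[of F f] F FE(1) by blast
    have "P \<cdot> iD f \<cdot> P \<in> gen"
      using compress_limit[of "\<lambda>n. iD (F n)"] FE iD_I f B.hom_continuous[of F f] F by blast
    then show "f \<in> ?E" using f by simp
  qed
  have "cstar_subalgebra (linfty N) ?E"
    unfolding cstar_subalgebra_def
  proof (intro conjI ballI sub)
    fix f assume f: "f \<in> ?E"
    then have fD: "f \<in> D" by simp
    note fB = B.hom_simps(1)[OF fD]
    have "star B (P \<cdot> iD f \<cdot> P) = P \<cdot> iD (\<lambda>y. cnj (f y)) \<cdot> P"
      using fB B.hom_simps(5)[OF fD] by (simp add: op_simps)
    then show "star (linfty N) f \<in> ?E"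
      using f B.C_closed(7)[OF fD] gen_closed(5)[of "P \<cdot> iD f \<cdot> P"] by simp
    fix h assume h: "h \<in> ?E"
    then have hD: "h \<in> D" by simp
    note hB = B.hom_simps(1)[OF hD]
    have "(P \<cdot> iD f \<cdot> P) \<cdot> (P \<cdot> iD h \<cdot> P) = (P \<cdot> iD f) \<cdot> (P \<cdot> iD h) \<cdot> P"
      using fB hB by (simp add: op_simps)
    also have "\<dots> = (P \<cdot> iD f) \<cdot> (iD h \<cdot> P) \<cdot> P" by (simp only: commute[OF hD])
    also have "\<dots> = P \<cdot> iD (\<lambda>y. f y * h y) \<cdot> P"
      using fB hB B.hom_simps(4)[OF fD hD] by (simp add: op_simps)
    finally show "f \<otimes>\<^bsub>linfty N\<^esub> h \<in> ?E"
      using f h B.C_closed(6)[OF fD hD] gen_closed(4)[of "P \<cdot> iD f \<cdot> P" "P \<cdot> iD h \<cdot> P"] by simp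
  qed
  moreover have "{charfun (x <# U) | x U. x \<in> N \<and> U \<in> conj_family G H M} \<subseteq> ?E"
  proof clarify
    fix x U assume x: "x \<in> N" and "U \<in> conj_family G H M"
    then obtain b where b: "b \<in> H" "U = conj_set G b M" by (auto simp: conj_family_def)
    obtain c where c: "c \<in> H_plus G H M" "conj_set G c M \<subseteq> conj_set G b M"
      using exists_H_plus_below[OF b(1)] by blast
    note cH = H_plus_H[OF c(1)]
    have UN: "conj_set G b M \<subseteq> N" by (rule conj_set_H(2)[OF b(1)])
    let ?\<F> = "(\<lambda>y. y <# conj_set G c M) ` ((\<lambda>v. x \<otimes> v) ` conj_set G b M)"
    have xUN: "(\<lambda>v. x \<otimes> v) ` conj_set G b M \<subseteq> N" using x UN subgroup_simps(1) by blast
    have "?\<F> = (\<lambda>C. x <# C) ` ((\<lambda>v. v <# conj_set G c M) ` conj_set G b M)"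
      using lcos_m_assoc[OF subgroup.subset[OF conj_set_H(1)[OF cH]] N_carrier[OF x]] N_carrier UN
      by (force simp: image_image intro!: image_cong)
    then have "finite ?\<F>" using finite_cosets[OF b(1) cH c(2)] by simp
    moreover have "pairwise disjnt ?\<F>"
      by (rule coset_family_disjoint[OF cH]) (use xUN N_carrier in blast)
    moreover have "charfun S \<in> ?E" if "S \<in> ?\<F>" for S
      using that xUN compress_small_coset[OF _ c(1)] charfun_coset_D[OF _ cH] by auto
    ultimately have "charfun (\<Union>?\<F>) \<in> ?E" using charfun_Union_mem[OF sub] by blast
    moreover have "\<Union>?\<F> = x <# U"
      using coset_family_Union[OF b(1) cH N_carrier[OF x] c(2)] b(2) by (simp add: image_image)
    ultimately show "charfun (x <# U) \<in> D \<and> P \<cdot> iD (charfun (x <# U)) \<cdot> P \<in> gen" by simp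
  qed
  ultimately have "cstar_generated (linfty N) {charfun (x <# U) | x U. x \<in> N \<and> U \<in> conj_family G H M} \<subseteq> ?E"
    by (rule cstar_generated_least)
  then show ?thesis using d by (auto simp: D_alg_def)
qed

text \<open>
  The elements of \<open>I\<close> with compression in the generated algebra form a closed subspace, which
  contains the spanning products by \<open>p d g p = (p d p) (p g p)\<close>.
\<close>

lemma generated_eq_corner:
  assumes comm: "comm_group (G\<lparr>carrier := H\<rparr>)"
    and N_union: "N = (\<Union>a\<in>H_plus G H M. conj_set G (inv a) M)"
  shows "gen = carrier cor"
proof
  let ?E = "{x \<in> I. P \<cdot> x \<cdot> P \<in> gen}"
  have IB: "x \<in> I \<Longrightarrow> x \<in> carrier B" for x using I_closed(1) by blast
  have sub: "closed_subspace B ?E"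
    unfolding closed_subspace_def
  proof (intro conjI ballI allI impI)
    show "?E \<subseteq> carrier B" using IB by blast
    show "\<zero>\<^bsub>B\<^esub> \<in> ?E"
      using I_closed(2) gen_closed(1) P_closed by (simp add: B.mult_zero_left B.mult_zero_right)
    fix x assume x: "x \<in> ?E"
    show "c \<odot>\<^bsub>B\<^esub> x \<in> ?E" for c
      using x IB[of x] I_closed(4)[of x c] gen_closed(3)[of "P \<cdot> x \<cdot> P" c] P_closed
      by (simp add: B.smult_mult_left B.smult_mult_right B.mult_closed)
    fix y assume y: "y \<in> ?E"
    show "x \<oplus>\<^bsub>B\<^esub> y \<in> ?E"
      using x y IB[of x] IB[of y] I_closed(3)[of x y] P_closed
        gen_closed(2)[of "P \<cdot> x \<cdot> P" "P \<cdot> y \<cdot> P"]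
      by (simp add: B.distrib_left B.distrib_right B.mult_closed)
  next
    fix X x assume X: "(\<forall>n. X n \<in> ?E) \<and> x \<in> carrier B \<and> cconv B X x"
    then have XE: "X n \<in> I" "P \<cdot> X n \<cdot> P \<in> gen" for n by auto
    have x: "x \<in> I" using I_closed(5)[of X x] X XE(1) by blast
    show "x \<in> ?E" using compress_limit[of X x] XE x X by blast
  qed
  have "iD d \<cdot> iG g \<in> ?E" if d: "d \<in> D" and g: "g \<in> carrier G" for d g
  proof -
    note dB = B.hom_simps(1)[OF d]
    have "iD d \<cdot> P = P \<cdot> iD d"
      using B.hom_simps(4)[OF charfun_M_D d] B.hom_simps(4)[OF d charfun_M_D] by (simp add: mult.commute)
    then have "P \<cdot> (iD d \<cdot> P) = P \<cdot> iD d" using dB by (simp add: P_P_left)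
    then have "P \<cdot> (iD d \<cdot> iG g) \<cdot> P = (P \<cdot> (iD d \<cdot> P)) \<cdot> iG g \<cdot> P"
      using dB g by (simp add: op_simps)
    also have "\<dots> = (P \<cdot> iD d \<cdot> P) \<cdot> (P \<cdot> iG g \<cdot> P)"
      using dB g by (simp add: op_simps)
    also have "\<dots> \<in> gen"
      by (rule gen_closed(4)[OF compress_function[OF d] compress_group_element[OF comm N_union g]])
    finally show ?thesis using iD_iG_I[OF d g] by simp
  qed
  then have "{iD d \<cdot> iG g | d g. d \<in> D \<and> g \<in> carrier G} \<subseteq> ?E" by blast
  from closed_span_least[OF sub this] have "I \<subseteq> ?E" unfolding I_span .
  then show "carrier cor \<subseteq> gen" by (auto simp: cor_def)
qed (rule gen_subset)

end

section \<open>The corner of the crossed product\<close>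

theorem lemma9p8:
  fixes G :: "('g, 'k) monoid_scheme" and N H M :: "'g set"
    and A :: "('a, 'n) cstar_alg_scheme"
    and iD :: "('g \<Rightarrow> complex) \<Rightarrow> 'a dcent" and iG :: "'g \<Rightarrow> 'a dcent"
    and p :: "'a dcent" and s u :: "'g \<Rightarrow> 'a dcent"
  assumes "semidirect_setting G N H M"
    and "crossed_product (D_alg G N H M) G (\<alpha>_act G N H) A iD iG"
    and "comm_group (G\<lparr>carrier := H\<rparr>)"
    and "N = (\<Union>a\<in>H_plus G H M. conj_set G (inv\<^bsub>G\<^esub> a) M)"
    and "p = iD (charfun M)"
    and "\<And>a. a \<in> H_plus G H M \<Longrightarrow> s a = p \<otimes>\<^bsub>multiplier A\<^esub> iG a \<otimes>\<^bsub>multiplier A\<^esub> p"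
    and "\<And>m. m \<in> M \<Longrightarrow> u m = p \<otimes>\<^bsub>multiplier A\<^esub> iG m \<otimes>\<^bsub>multiplier A\<^esub> p"
  shows "SU_family G H M (corner A p) s u \<and>
         cstar_generated (corner A p) (s ` H_plus G H M \<union> u ` M) = carrier (corner A p)"
proof -
  have cp: "cstar_algebra A" "covariant_hom D G \<alpha> A iD iG" if "crossed_product D G \<alpha> A iD iG" for D \<alpha>
    using that unfolding crossed_product_def by blast+
  have span: "closed_span (multiplier A) {iD d \<otimes>\<^bsub>multiplier A\<^esub> iG g | d g. d \<in> carrier D \<and> g \<in> carrier G}
       = mult_embed A ` carrier A" if "crossed_product D G \<alpha> A iD iG" for D \<alpha>
    using that unfolding crossed_product_def by blast
  interpret S: semidirect_setting G N H M by fact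
  interpret A: cstar_algebra A using cp(1) assms(2) .
  interpret MA: unital_cstar_algebra "multiplier A" by (rule A.unital_cstar_algebra_multiplier)
  note cov = cp(2)[OF assms(2), unfolded covariant_hom_def]
  have D_eq: "D_alg G N H M = (linfty N)\<lparr>carrier := carrier (D_alg G N H M)\<rparr>"
    by (simp add: D_alg_def)
  have D_sub: "cstar_subalgebra (linfty N) (carrier (D_alg G N H M))"
  proof -
    have "charfun (x <#\<^bsub>G\<^esub> U) \<in> carrier (linfty N)" if "x \<in> N" "U \<in> conj_family G H M" for x U
    proof (rule linfty_carrierI[where K = 1])
      have "U \<subseteq> N" using that(2) S.conj_set_H(2) by (auto simp: conj_family_def)
      then show "charfun (x <#\<^bsub>G\<^esub> U) y = 0" if "y \<notin> N" for y
        using that \<open>x \<in> N\<close> S.subgroup_simps(1) by (auto simp: charfun_def l_coset_def)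
    qed (simp add: charfun_def)
    then show ?thesis
      unfolding D_alg_def by simp (rule cstar_subalgebra_cstar_generated[OF cstar_subalgebra_linfty], blast)
  qed
  interpret covariant_corner G N H M "multiplier A" iD iG "mult_embed A ` carrier A" s u
  proof unfold_locales
    show "N \<noteq> {}" using S.subgroup_simps(3) by blast
    show "cstar_subalgebra (linfty N) (carrier (D_alg G N H M))" by (rule D_sub)
    show "iD \<in> cstar_hom ((linfty N)\<lparr>carrier := carrier (D_alg G N H M)\<rparr>) (multiplier A)"
      using cov D_eq by simp
    show "closed_span (multiplier A) {iD d \<otimes>\<^bsub>multiplier A\<^esub> iG g | d g. d \<in> carrier (D_alg G N H M) \<and> g \<in> carrier G}
       = mult_embed A ` carrier A" by (rule span[OF assms(2)])
    fix t x assume "t \<in> carrier (multiplier A)" "x \<in> mult_embed A ` carrier A"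
    then show "t \<otimes>\<^bsub>multiplier A\<^esub> x \<in> mult_embed A ` carrier A \<and> x \<otimes>\<^bsub>multiplier A\<^esub> t \<in> mult_embed A ` carrier A"
      using A.mult_embed_ideal(1,2)[of t] A.double_centralisersD(1,2)[of t] by auto
  next
    fix x assume "x \<in> mult_embed A ` carrier A"
    then show "star (multiplier A) x \<in> mult_embed A ` carrier A"
      using A.mult_embed_ideal(3)[OF A.multiplier_ops_closed(2)] A.star_closed by auto
  qed (use cov assms(5-7) in auto)
  have "corner A p = cor"
    by (simp add: corner_def cor_def assms(5) image_image)
  then show ?thesis using SU_family_corner generated_eq_corner[OF assms(3,4)] by simp
qed

end
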